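(* Let $(M,g,V)$ be an almost para-quaternion-Hermitian manifold, with Levi-Civita connection $\nabla$ of $g$ and associated global 4-form $\Omega$. Suppose that $M$ is nearly para-quaternion Kähler, that is, $(\nabla_X \Omega)(X,Y,Z,W)=0$ for all tangent vectors $X,Y,Z,W\in T_pM$ at every point $p\in M$. Then $M$ is para-quaternion Kähler, that is, $V$ is invariant under covariant differentiation with respect to $\nabla$: for every local smooth section $A$ of $V$ and every vector field $X$, the endomorphism field $\nabla_X A$ is again a local section of $V$.
   Context: Let $(M,g)$ be a (smooth) pseudo-Riemannian manifold. A para-quaternion-Hermitian structure on $(M,g)$ is a smooth rank-3 vector subbundle $V$ of $\mathrm{End}(TM)$ which locally (in a neighbourhood of every point) admits a basis $I,J,K$ of sections that are skew-symmetric with respect to $g$ (i.e. $g(AX,Y)=-g(X,AY)$ for $A\in\{I,J,K\}$) and satisfy $$I^2=-J^2=-K^2=-\mathrm{Id},\qquad IJ=-JI=K,\qquad JK=-KJ=-I,\qquad KI=-IK=J.$$ The triple $(M,g,V)$ is then called an almost para-quaternion-Hermitian manifold. It follows that $\dim M=4m$ and that $g$ has neutral signature $(2m,2m)$. For such a local basis $I,J,K$ define local 2-forms $\Omega_I(X,Y)=g(X,IY)$, $\Omega_J(X,Y)=g(X,JY)$, $\Omega_K(X,Y)=g(X,KY)$. The 4-form $$\Omega=\Omega_I\wedge\Omega_I-\Omega_J\wedge\Omega_J-\Omega_K\wedge\Omega_K$$ does not depend on the choice of local basis and hence is globally well defined on $M$. The wedge product is normalized so that $(\Omega_I\wedge\Omega_I)(X,Y,Z,W)=2\sum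 \Omega_I(X,Y)\Omega_I(Z,W)$, where the sum runs over the cyclic permutations of $(Y,Z,W)$, and similarly for $J$ and $K$. *)

theory Defs
  imports "HOL-Analysis.Analysis" "HOL-Library.Function_Algebras"
begin

text \<open>Functions into a real vector space form a real vector space under the pointwise
  operations. Both tangent vectors and endomorphisms of tangent spaces are functions below, so
  \<^const>\<open>span\<close> and \<^const>\<open>independent\<close> apply to them.\<close>

instantiation "fun" :: (type, scaleR) scaleR
begin
definition scaleR_fun :: "real \<Rightarrow> ('a \<Rightarrow> 'b) \<Rightarrow> 'a \<Rightarrow> 'b"
  where "scaleR_fun r f = (\<lambda>x. r *\<^sub>R f x)"
instance ..
end

instance "fun" :: (type, real_vector) real_vector
  by standard
    (simp_all add: scaleR_fun_def plus_fun_def fun_eq_iff scaleR_add_right scaleR_add_left)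


section \<open>Smooth manifolds\<close>

text \<open>\<^term>\<open>Ck_on k S f\<close> is only used for open \<^term>\<open>S\<close>.\<close>

primrec Ck_on :: "nat \<Rightarrow> 'a::real_normed_vector set \<Rightarrow> ('a \<Rightarrow> 'b::real_normed_vector) \<Rightarrow> bool"
  where
    "Ck_on 0 S f \<longleftrightarrow> continuous_on S f"
  | "Ck_on (Suc k) S f \<longleftrightarrow>
       (\<forall>x\<in>S. f differentiable (at x)) \<and>
       (\<forall>v. Ck_on k S (\<lambda>x. frechet_derivative f (at x) v))"

definition smooth_on :: "'a::real_normed_vector set \<Rightarrow> ('a \<Rightarrow> 'b::real_normed_vector) \<Rightarrow> bool"
  where "smooth_on S f \<longleftrightarrow> (\<forall>k. Ck_on k S f)"

text \<open>A chart is a domain together with a coordinate map (relevant on the domain only).\<close>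

type_synonym ('m, 'e) chart = "'m set \<times> ('m \<Rightarrow> 'e)"

definition chart_inv :: "('m, 'e) chart \<Rightarrow> 'e \<Rightarrow> 'm"
  where "chart_inv c = inv_into (fst c) (snd c)"

record ('m, 'e) manifold =
  mtop :: "'m topology"
  atlas :: "('m, 'e) chart set"

text \<open>The atlas need not be maximal: all notions below are unchanged if it is enlarged by
  compatible charts. The dimension of the manifold is \<open>DIM('e)\<close>.\<close>

definition smooth_manifold :: "('m, 'e::euclidean_space) manifold \<Rightarrow> bool"
  where "smooth_manifold M \<longleftrightarrow>
    Hausdorff_space (mtop M) \<and> second_countable (mtop M) \<and>
    (\<Union>c\<in>atlas M. fst c) = topspace (mtop M) \<and>
    (\<forall>(U, \<phi>)\<in>atlas M. openin (mtop M) U \<and> open (\<phi> ` U) \<and>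
       homeomorphic_map (subtopology (mtop M) U) (top_of_set (\<phi> ` U)) \<phi>) \<and>
    (\<forall>c\<in>atlas M. \<forall>d\<in>atlas M. smooth_on (snd c ` (fst c \<inter> fst d)) (snd d \<circ> chart_inv c))"

definition charts_at :: "('m, 'e) manifold \<Rightarrow> 'm \<Rightarrow> ('m, 'e) chart set"
  where "charts_at M p = {c \<in> atlas M. p \<in> fst c}"

text \<open>A tangent vector at \<^term>\<open>p\<close> is the family of its coordinate vectors in all charts around
  \<^term>\<open>p\<close>, related by the derivatives of the coordinate changes; the components at the other
  charts carry no information and are set to 0.\<close>

type_synonym ('m, 'e) tvec = "('m, 'e) chart \<Rightarrow> 'e"

definition tangent_space :: "('m, 'e::euclidean_space) manifold \<Rightarrow> 'm \<Rightarrow> ('m, 'e) tvec set"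
  where "tangent_space M p =
    {v. (\<forall>c\<in>charts_at M p. \<forall>d\<in>charts_at M p.
           v d = frechet_derivative (snd d \<circ> chart_inv c) (at (snd c p)) (v c)) \<and>
        (\<forall>c. c \<notin> charts_at M p \<longrightarrow> v c = 0)}"

definition smooth_function :: "('m, 'e::euclidean_space) manifold \<Rightarrow> 'm set \<Rightarrow> ('m \<Rightarrow> real) \<Rightarrow> bool"
  where "smooth_function M U f \<longleftrightarrow>
    (\<forall>c\<in>atlas M. smooth_on (snd c ` (fst c \<inter> U)) (f \<circ> chart_inv c))"

text \<open>The derivative of \<^term>\<open>f\<close> in the direction of the tangent vector \<^term>\<open>v\<close> at
  \<^term>\<open>p\<close>; by the chain rule the value is the same in every chart.\<close>

definition dir_deriv ::
    "('m, 'e::euclidean_space) manifold \<Rightarrow> 'm \<Rightarrow> ('m, 'e) tvec \<Rightarrow> ('m \<Rightarrow> real) \<Rightarrow> real"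
  where "dir_deriv M p v f =
    (let c = (SOME c. c \<in> charts_at M p)
     in frechet_derivative (f \<circ> chart_inv c) (at (snd c p)) (v c))"

definition vector_field ::
    "('m, 'e::euclidean_space) manifold \<Rightarrow> 'm set \<Rightarrow> ('m \<Rightarrow> ('m, 'e) tvec) \<Rightarrow> bool"
  where "vector_field M U X \<longleftrightarrow>
    (\<forall>p\<in>U. X p \<in> tangent_space M p) \<and>
    (\<forall>c\<in>atlas M. smooth_on (snd c ` (fst c \<inter> U)) (\<lambda>u. X (chart_inv c u) c))"

text \<open>Some local smooth vector field with prescribed value at \<^term>\<open>p\<close>; it serves to evaluate
  tensorial expressions, whose value does not depend on this choice.\<close>

definition extend_tvec ::
    "('m, 'e::euclidean_space) manifold \<Rightarrow> 'm \<Rightarrow> ('m, 'e) tvec \<Rightarrow> 'm \<Rightarrow> ('m, 'e) tvec"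
  where "extend_tvec M p y =
    (SOME Y. (\<exists>U. openin (mtop M) U \<and> p \<in> U \<and> vector_field M U Y) \<and> Y p = y)"


section \<open>Metrics and connections\<close>

definition linear_on_subspace :: "'a::real_vector set \<Rightarrow> ('a \<Rightarrow> 'b::real_vector) \<Rightarrow> bool"
  where "linear_on_subspace T f \<longleftrightarrow>
    (\<forall>x\<in>T. \<forall>y\<in>T. f (x + y) = f x + f y) \<and> (\<forall>x\<in>T. \<forall>r. f (r *\<^sub>R x) = r *\<^sub>R f x)"

type_synonym ('m, 'e) tensor2 = "'m \<Rightarrow> ('m, 'e) tvec \<Rightarrow> ('m, 'e) tvec \<Rightarrow> real"

definition pseudo_riemannian_metric ::
    "('m, 'e::euclidean_space) manifold \<Rightarrow> ('m, 'e) tensor2 \<Rightarrow> bool"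
  where "pseudo_riemannian_metric M g \<longleftrightarrow>
    (\<forall>p\<in>topspace (mtop M).
       (\<forall>x\<in>tangent_space M p. linear_on_subspace (tangent_space M p) (g p x)) \<and>
       (\<forall>x\<in>tangent_space M p. \<forall>y\<in>tangent_space M p. g p x y = g p y x) \<and>
       (\<forall>x\<in>tangent_space M p. (\<forall>y\<in>tangent_space M p. g p x y = 0) \<longrightarrow> x = 0)) \<and>
    (\<forall>U X Y. openin (mtop M) U \<and> vector_field M U X \<and> vector_field M U Y \<longrightarrow>
       smooth_function M U (\<lambda>p. g p (X p) (Y p)))"

text \<open>\<^term>\<open>D p x Y\<close> is the covariant derivative at \<^term>\<open>p\<close> of the vector field
  \<^term>\<open>Y\<close>, defined near \<^term>\<open>p\<close>, in the direction of the tangent vector \<^term>\<open>x\<close>.\<close>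

type_synonym ('m, 'e) connection =
  "'m \<Rightarrow> ('m, 'e) tvec \<Rightarrow> ('m \<Rightarrow> ('m, 'e) tvec) \<Rightarrow> ('m, 'e) tvec"

definition affine_connection ::
    "('m, 'e::euclidean_space) manifold \<Rightarrow> ('m, 'e) connection \<Rightarrow> bool"
  where "affine_connection M D \<longleftrightarrow>
    (\<forall>U. openin (mtop M) U \<longrightarrow>
      (\<forall>Y. vector_field M U Y \<longrightarrow>
        (\<forall>p\<in>U. (\<forall>x\<in>tangent_space M p. D p x Y \<in> tangent_space M p) \<and>
           linear_on_subspace (tangent_space M p) (\<lambda>x. D p x Y)) \<and>
        (\<forall>Z. vector_field M U Z \<longrightarrow>
           (\<forall>p\<in>U. \<forall>x\<in>tangent_space M p.
              D p x (\<lambda>q. Y q + Z q) = D p x Y + D p x Z \<and>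
              ((\<forall>q\<in>U. Y q = Z q) \<longrightarrow> D p x Y = D p x Z))) \<and>
        (\<forall>f. smooth_function M U f \<longrightarrow>
           (\<forall>p\<in>U. \<forall>x\<in>tangent_space M p.
              D p x (\<lambda>q. f q *\<^sub>R Y q) = dir_deriv M p x f *\<^sub>R Y p + f p *\<^sub>R D p x Y)) \<and>
        (\<forall>X. vector_field M U X \<longrightarrow> vector_field M U (\<lambda>p. D p (X p) Y))))"

definition torsion_free ::
    "('m, 'e::euclidean_space) manifold \<Rightarrow> ('m, 'e) connection \<Rightarrow> bool"
  where "torsion_free M D \<longleftrightarrow>
    (\<forall>U X Y f. openin (mtop M) U \<and> vector_field M U X \<and> vector_field M U Y \<and>
       smooth_function M U f \<longrightarrow>
       (\<forall>p\<in>U. dir_deriv M p (D p (X p) Y - D p (Y p) X) f =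
          dir_deriv M p (X p) (\<lambda>q. dir_deriv M q (Y q) f) -
          dir_deriv M p (Y p) (\<lambda>q. dir_deriv M q (X q) f)))"

definition metric_compatible ::
    "('m, 'e::euclidean_space) manifold \<Rightarrow> ('m, 'e) tensor2 \<Rightarrow> ('m, 'e) connection \<Rightarrow> bool"
  where "metric_compatible M g D \<longleftrightarrow>
    (\<forall>U Y Z. openin (mtop M) U \<and> vector_field M U Y \<and> vector_field M U Z \<longrightarrow>
       (\<forall>p\<in>U. \<forall>x\<in>tangent_space M p.
          dir_deriv M p x (\<lambda>q. g q (Y q) (Z q)) = g p (D p x Y) (Z p) + g p (Y p) (D p x Z)))"

definition levi_civita_connection ::
    "('m, 'e::euclidean_space) manifold \<Rightarrow> ('m, 'e) tensor2 \<Rightarrow> ('m, 'e) connection \<Rightarrow> bool"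
  where "levi_civita_connection M g D \<longleftrightarrow>
    affine_connection M D \<and> torsion_free M D \<and> metric_compatible M g D"


section \<open>Subbundles of the endomorphism bundle\<close>

type_synonym ('m, 'e) tend = "('m, 'e) tvec \<Rightarrow> ('m, 'e) tvec"

text \<open>Endomorphisms of a tangent space are extended by 0 outside of it, so that they form a
  vector space isomorphic to the endomorphisms proper.\<close>

definition endo_space :: "('m, 'e::euclidean_space) manifold \<Rightarrow> 'm \<Rightarrow> ('m, 'e) tend set"
  where "endo_space M p =
    {A. (\<forall>x\<in>tangent_space M p. A x \<in> tangent_space M p) \<and>
        linear_on_subspace (tangent_space M p) A \<and>
        (\<forall>x. x \<notin> tangent_space M p \<longrightarrow> A x = 0)}"

text \<open>Smoothness of a field of endomorphisms: it maps smooth vector fields to smooth ones.\<close>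

definition endo_field ::
    "('m, 'e::euclidean_space) manifold \<Rightarrow> 'm set \<Rightarrow> ('m \<Rightarrow> ('m, 'e) tend) \<Rightarrow> bool"
  where "endo_field M U A \<longleftrightarrow>
    (\<forall>p\<in>U. A p \<in> endo_space M p) \<and>
    (\<forall>W Y. openin (mtop M) W \<and> W \<subseteq> U \<and> vector_field M W Y \<longrightarrow>
       vector_field M W (\<lambda>p. A p (Y p)))"

definition section_on ::
    "('m, 'e::euclidean_space) manifold \<Rightarrow> ('m \<Rightarrow> ('m, 'e) tend set) \<Rightarrow> 'm set \<Rightarrow>
      ('m \<Rightarrow> ('m, 'e) tend) \<Rightarrow> bool"
  where "section_on M V U A \<longleftrightarrow> endo_field M U A \<and> (\<forall>p\<in>U. A p \<in> V p)"

definition smooth_subbundle ::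
    "('m, 'e::euclidean_space) manifold \<Rightarrow> nat \<Rightarrow> ('m \<Rightarrow> ('m, 'e) tend set) \<Rightarrow> bool"
  where "smooth_subbundle M k V \<longleftrightarrow>
    (\<forall>p\<in>topspace (mtop M). \<exists>U s. openin (mtop M) U \<and> p \<in> U \<and>
       (\<forall>i<k. endo_field M U (s i)) \<and>
       (\<forall>q\<in>U. inj_on (\<lambda>i. s i q) {..<k} \<and> independent ((\<lambda>i. s i q) ` {..<k}) \<and>
          V q = span ((\<lambda>i. s i q) ` {..<k})))"


section \<open>Para-quaternion-Hermitian structures\<close>

definition skew_at ::
    "('m, 'e::euclidean_space) manifold \<Rightarrow> ('m, 'e) tensor2 \<Rightarrow> 'm \<Rightarrow> ('m, 'e) tend \<Rightarrow> bool"
  where "skew_at M g p A \<longleftrightarrow>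
    (\<forall>x\<in>tangent_space M p. \<forall>y\<in>tangent_space M p. g p (A x) y = - g p x (A y))"

definition para_quaternion_relations :: "'a::real_vector set \<Rightarrow> ('a \<Rightarrow> 'a) \<Rightarrow> ('a \<Rightarrow> 'a) \<Rightarrow> ('a \<Rightarrow> 'a) \<Rightarrow> bool"
  where "para_quaternion_relations T I J K \<longleftrightarrow>
    (\<forall>x\<in>T. I (I x) = - x \<and> J (J x) = x \<and> K (K x) = x \<and>
       I (J x) = K x \<and> J (I x) = - K x \<and>
       J (K x) = - I x \<and> K (J x) = I x \<and>
       K (I x) = J x \<and> I (K x) = - J x)"

definition pq_basis_at ::
    "('m, 'e::euclidean_space) manifold \<Rightarrow> ('m, 'e) tensor2 \<Rightarrow> ('m \<Rightarrow> ('m, 'e) tend set) \<Rightarrow> 'm \<Rightarrow>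
      ('m, 'e) tend \<Rightarrow> ('m, 'e) tend \<Rightarrow> ('m, 'e) tend \<Rightarrow> bool"
  where "pq_basis_at M g V p I J K \<longleftrightarrow>
    I \<in> endo_space M p \<and> J \<in> endo_space M p \<and> K \<in> endo_space M p \<and>
    card {I, J, K} = 3 \<and> independent {I, J, K} \<and> V p = span {I, J, K} \<and>
    skew_at M g p I \<and> skew_at M g p J \<and> skew_at M g p K \<and>
    para_quaternion_relations (tangent_space M p) I J K"

definition almost_para_quaternion_hermitian ::
    "('m, 'e::euclidean_space) manifold \<Rightarrow> ('m, 'e) tensor2 \<Rightarrow> ('m \<Rightarrow> ('m, 'e) tend set) \<Rightarrow> bool"
  where "almost_para_quaternion_hermitian M g V \<longleftrightarrow>
    smooth_manifold M \<and> pseudo_riemannian_metric M g \<and> smooth_subbundle M 3 V \<and>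
    (\<forall>p\<in>topspace (mtop M). \<exists>U I J K. openin (mtop M) U \<and> p \<in> U \<and>
       endo_field M U I \<and> endo_field M U J \<and> endo_field M U K \<and>
       (\<forall>q\<in>U. pq_basis_at M g V q (I q) (J q) (K q)))"

definition two_form ::
    "('m, 'e::euclidean_space) tensor2 \<Rightarrow> 'm \<Rightarrow> ('m, 'e) tend \<Rightarrow> ('m, 'e) tvec \<Rightarrow> ('m, 'e) tvec \<Rightarrow> real"
  where "two_form g p A = (\<lambda>x y. g p x (A y))"

text \<open>The normalisation of the wedge product used here has the factor 2 in front of the sum over
  the cyclic permutations of the last three arguments.\<close>

definition wedge_square :: "('a \<Rightarrow> 'a \<Rightarrow> real) \<Rightarrow> 'a \<Rightarrow> 'a \<Rightarrow> 'a \<Rightarrow> 'a \<Rightarrow> real"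
  where "wedge_square \<omega> x y z w = 2 * (\<omega> x y * \<omega> z w + \<omega> x z * \<omega> w y + \<omega> x w * \<omega> y z)"

text \<open>The value at a point does not depend on the chosen basis, since any two such bases of
  \<^term>\<open>V p\<close> differ by an element of \<open>SO(1,2)\<close>.\<close>

definition fundamental_form ::
    "('m, 'e::euclidean_space) manifold \<Rightarrow> ('m, 'e) tensor2 \<Rightarrow> ('m \<Rightarrow> ('m, 'e) tend set) \<Rightarrow> 'm \<Rightarrow>
      ('m, 'e) tvec \<Rightarrow> ('m, 'e) tvec \<Rightarrow> ('m, 'e) tvec \<Rightarrow> ('m, 'e) tvec \<Rightarrow> real"
  where "fundamental_form M g V p =
    (let (I, J, K) = (SOME (I, J, K). pq_basis_at M g V p I J K)
     in (\<lambda>x y z w. wedge_square (two_form g p I) x y z w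
                 - wedge_square (two_form g p J) x y z w
                 - wedge_square (two_form g p K) x y z w))"

text \<open>Covariant derivatives of covariant 4-tensor fields and of endomorphism fields, in the
  direction of a tangent vector \<^term>\<open>x\<close> at \<^term>\<open>p\<close>.\<close>

definition cov_deriv_form4 ::
    "('m, 'e::euclidean_space) manifold \<Rightarrow> ('m, 'e) connection \<Rightarrow>
      ('m \<Rightarrow> ('m, 'e) tvec \<Rightarrow> ('m, 'e) tvec \<Rightarrow> ('m, 'e) tvec \<Rightarrow> ('m, 'e) tvec \<Rightarrow> real) \<Rightarrow> 'm \<Rightarrow>
      ('m, 'e) tvec \<Rightarrow> ('m, 'e) tvec \<Rightarrow> ('m, 'e) tvec \<Rightarrow> ('m, 'e) tvec \<Rightarrow> ('m, 'e) tvec \<Rightarrow> real"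
  where "cov_deriv_form4 M D F p x y z w u =
    (let Y = extend_tvec M p y; Z = extend_tvec M p z;
         W = extend_tvec M p w; U = extend_tvec M p u
     in dir_deriv M p x (\<lambda>q. F q (Y q) (Z q) (W q) (U q))
        - F p (D p x Y) z w u - F p y (D p x Z) w u
        - F p y z (D p x W) u - F p y z w (D p x U))"

definition cov_deriv_endo ::
    "('m, 'e::euclidean_space) manifold \<Rightarrow> ('m, 'e) connection \<Rightarrow> ('m \<Rightarrow> ('m, 'e) tend) \<Rightarrow> 'm \<Rightarrow>
      ('m, 'e) tvec \<Rightarrow> ('m, 'e) tend"
  where "cov_deriv_endo M D A p x =
    (\<lambda>y. if y \<in> tangent_space M p
         then let Y = extend_tvec M p y in D p x (\<lambda>q. A q (Y q)) - A p (D p x Y)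
         else 0)"

definition nearly_para_quaternion_kaehler ::
    "('m, 'e::euclidean_space) manifold \<Rightarrow> ('m, 'e) tensor2 \<Rightarrow> ('m \<Rightarrow> ('m, 'e) tend set) \<Rightarrow>
      ('m, 'e) connection \<Rightarrow> bool"
  where "nearly_para_quaternion_kaehler M g V D \<longleftrightarrow>
    (\<forall>p\<in>topspace (mtop M). \<forall>x\<in>tangent_space M p. \<forall>y\<in>tangent_space M p.
       \<forall>z\<in>tangent_space M p. \<forall>w\<in>tangent_space M p.
       cov_deriv_form4 M D (fundamental_form M g V) p x x y z w = 0)"

definition para_quaternion_kaehler ::
    "('m, 'e::euclidean_space) manifold \<Rightarrow> ('m \<Rightarrow> ('m, 'e) tend set) \<Rightarrow>
      ('m, 'e) connection \<Rightarrow> bool"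
  where "para_quaternion_kaehler M V D \<longleftrightarrow>
    (\<forall>U A X. openin (mtop M) U \<and> section_on M V U A \<and> vector_field M U X \<longrightarrow>
       section_on M V U (\<lambda>p. cov_deriv_endo M D A p (X p)))"

end

theory Submission
  imports Defs
begin

text \<open>
  Fix a point and a local basis \<open>I, J, K\<close> of \<open>V\<close>. Differentiating the relations shows that
  \<open>\<nabla>\<^sub>x I = 2(RJ - QK)\<close>, \<open>\<nabla>\<^sub>x J = 2(PK + RI)\<close>, \<open>\<nabla>\<^sub>x K = -2(PJ + QI)\<close>, where \<open>P, Q, R\<close> are
  symmetric, commute with \<open>I, J, K\<close> and depend linearly on \<open>x\<close>; the claim is that they are scalars.
  Let \<open>x\<close> be non-null and let \<open>H\<close> be the span of \<open>x, Ix, Jx, Kx\<close>. The equation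
  \<open>(\<nabla>\<^sub>x \<Omega>)(x, Ix, w, u) = 0\<close> and its analogues for \<open>J\<close> and \<open>K\<close>, for \<open>w, u\<close> orthogonal to \<open>H\<close>,
  say that \<open>P, Q, R\<close> act as scalars on the orthogonal complement of \<open>H\<close>, while
  \<open>(\<nabla>\<^sub>x \<Omega>)(x, Ix, Jx, u) = 0\<close> and its analogues give \<open>g(x, Pu) = g(x, Qu) = g(x, Ru) = 0\<close>.
  Hence \<open>P, Q, R\<close> are scalars. A null vector is a difference of non-null ones.
\<close>

section \<open>Smooth maps between normed spaces\<close>

text \<open>Each of \<open>P\<close>, \<open>Q\<close>, \<open>R\<close> has two expressions,
  because the anticommutation relations can be differentiated: \<open>R\<close>, for instance, is up
  to a factor both \<open>I' J + J I'\<close> and \<open>- (J' I + I J')\<close>, and each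
  expression makes one commutation rule evident. An equation in two vectors orthogonal to
  \<open>H\<close> splits into a symmetric and a skew part, so that a single equation controls two
  operators. The step to null vectors works because lying in the span of \<open>I\<close>,
  \<open>J\<close>, \<open>K\<close> is a linear condition, although the scalars are found
  separately for each non-null direction. On the analytic side, arbitrary choices have to be
  neutralised. \<open>fundamental_form\<close> selects a basis at each point with no smoothness in
  the point; a computation with anticommutators shows that its value is the same for all adapted
  bases. \<open>cov_deriv_endo\<close> selects an extension of a vector; skewness moves the
  derivative to the other argument of \<open>g\<close> and leaves only the value at the point, so
  that no frames of vector fields are required. Coefficients of a section in a local basis are
  obtained through \<open>g\<close> up to a smooth factor, and it is the multiplied section that is
  differentiated.\<close>

lemma frechet_derivative_cong_open:
  assumes "open S" "x \<in> S" "\<And>y. y \<in> S \<Longrightarrow> f y = h y"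
  shows "frechet_derivative f (at x) = frechet_derivative h (at x)"
proof -
  have "(f has_derivative F) (at x) \<longleftrightarrow> (h has_derivative F) (at x)" for F
    using has_derivative_transform_within_open[of f F x UNIV S h]
      has_derivative_transform_within_open[of h F x UNIV S f] assms by auto
  then show ?thesis by (simp add: frechet_derivative_def)
qed

lemma differentiable_cong_open:
  assumes "open S" "x \<in> S" "\<And>y. y \<in> S \<Longrightarrow> f y = h y" "f differentiable (at x)"
  shows "h differentiable (at x)"
  using assms unfolding differentiable_def
  by (metis has_derivative_transform_within_open)

text \<open>Openness of \<open>S\<close> matters: \<open>frechet_derivative\<close> at a point of
  \<open>S\<close> sees a full neighbourhood, on which both functions have to agree.\<close>

lemma Ck_on_cong:
  assumes "open S" "\<And>x. x \<in> S \<Longrightarrow> f x = h x" "Ck_on k S f"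
  shows "Ck_on k S h"
  using assms
proof (induction k arbitrary: f h)
  case 0
  then show ?case using continuous_on_cong[of S S f h] by auto
next
  case (Suc k)
  have "Ck_on k S (\<lambda>x. frechet_derivative h (at x) v)" for v
    by (rule Suc.IH[of "\<lambda>x. frechet_derivative f (at x) v"])
      (use Suc.prems frechet_derivative_cong_open[OF Suc.prems(1) _ Suc.prems(2)] in auto)
  then show ?case
    using differentiable_cong_open[OF Suc.prems(1) _ Suc.prems(2)] Suc.prems(3) by auto
qed

lemma Ck_on_subset: "Ck_on k S f \<Longrightarrow> S' \<subseteq> S \<Longrightarrow> Ck_on k S' f"
  by (induction k arbitrary: f) (auto intro: continuous_on_subset)

lemma Ck_on_SucD: "Ck_on (Suc k) S f \<Longrightarrow> Ck_on k S f"
proof (induction k arbitrary: f)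
  case 0
  then show ?case
    by (auto intro!: continuous_at_imp_continuous_on differentiable_imp_continuous_within)
next
  case (Suc k)
  then show ?case by (subst Ck_on.simps) (metis Ck_on.simps(2))
qed

lemma Ck_on_const: "Ck_on k S (\<lambda>x. c)"
  by (induction k arbitrary: c) auto

lemma Ck_on_bounded_linear:
  assumes "open S" "bounded_linear L" "Ck_on k S f"
  shows "Ck_on k S (\<lambda>x. L (f x))"
  using assms(3)
proof (induction k arbitrary: f)
  case 0
  then show ?case
    using bounded_linear.continuous_on[OF assms(2)] by simp
next
  case (Suc k)
  have d: "((\<lambda>x. L (f x)) has_derivative (\<lambda>v. L (frechet_derivative f (at x) v))) (at x)" if "x \<in> S" for x
    using Suc.prems that by (auto simp: frechet_derivative_works
      intro: bounded_linear.has_derivative[OF assms(2)])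
  have e: "frechet_derivative (\<lambda>x. L (f x)) (at x) = (\<lambda>v. L (frechet_derivative f (at x) v))" if "x \<in> S" for x
    using frechet_derivative_at[OF d[OF that]] by simp
  have "Ck_on k S (\<lambda>x. frechet_derivative (\<lambda>x. L (f x)) (at x) v)" for v
    by (rule Ck_on_cong[OF assms(1) _ Suc.IH[of "\<lambda>x. frechet_derivative f (at x) v"]])
      (use Suc.prems e in auto)
  then show ?case using d by (auto simp: differentiable_def)
qed

lemma Ck_on_add:
  assumes "open S" "Ck_on k S f" "Ck_on k S h"
  shows "Ck_on k S (\<lambda>x. f x + h x)"
  using assms(2,3)
proof (induction k arbitrary: f h)
  case 0
  then show ?case by (auto intro: continuous_on_add)
next
  case (Suc k)
  have d: "((\<lambda>x. f x + h x) has_derivative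
      (\<lambda>v. frechet_derivative f (at x) v + frechet_derivative h (at x) v)) (at x)" if "x \<in> S" for x
    using Suc.prems that by (auto simp: frechet_derivative_works intro: has_derivative_add)
  have "Ck_on k S (\<lambda>x. frechet_derivative (\<lambda>x. f x + h x) (at x) v)" for v
    by (rule Ck_on_cong[OF assms(1) _ Suc.IH[of "\<lambda>x. frechet_derivative f (at x) v"
          "\<lambda>x. frechet_derivative h (at x) v"]])
      (use Suc.prems frechet_derivative_at[OF d] in \<open>auto simp: fun_eq_iff\<close>)
  then show ?case using d by (auto simp: differentiable_def)
qed

lemma Ck_on_scaleR:
  fixes f :: "'a::real_normed_vector \<Rightarrow> real"
  assumes "open S" "Ck_on k S f" "Ck_on k S h"
  shows "Ck_on k S (\<lambda>x. f x *\<^sub>R h x)"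
  using assms(2,3)
proof (induction k arbitrary: f h)
  case 0
  then show ?case by (auto intro: continuous_on_scaleR)
next
  case (Suc k)
  have d: "((\<lambda>x. f x *\<^sub>R h x) has_derivative
      (\<lambda>v. f x *\<^sub>R frechet_derivative h (at x) v + frechet_derivative f (at x) v *\<^sub>R h x)) (at x)" if "x \<in> S" for x
    using Suc.prems that by (auto simp: frechet_derivative_works intro: has_derivative_scaleR)
  have "Ck_on k S (\<lambda>x. f x *\<^sub>R frechet_derivative h (at x) v + frechet_derivative f (at x) v *\<^sub>R h x)" for v
    using Suc.prems Suc.prems[THEN Ck_on_SucD] by (intro Ck_on_add[OF assms(1)] Suc.IH) auto
  then have "Ck_on k S (\<lambda>x. frechet_derivative (\<lambda>x. f x *\<^sub>R h x) (at x) v)" for v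
    by (rule Ck_on_cong[OF assms(1), rotated])
      (use frechet_derivative_at[OF d] in \<open>auto simp: fun_eq_iff\<close>)
  then show ?case using d by (auto simp: differentiable_def)
qed

lemma Ck_on_sum:
  assumes "open S" "finite B" "\<And>i. i \<in> B \<Longrightarrow> Ck_on k S (f i)"
  shows "Ck_on k S (\<lambda>x. \<Sum>i\<in>B. f i x)"
  using assms(2,3) by (induction B) (auto intro: Ck_on_const Ck_on_add[OF assms(1)])

text \<open>\<open>Ck_on\<close> speaks of derivatives in fixed directions, while the chain rule
  feeds the varying vector \<open>h' x v\<close> into the derivative of \<open>f\<close>. Expanding
  that vector over \<open>Basis\<close> gives a sum of products of directional derivatives of
  \<open>f\<close> composed with \<open>h\<close>, to which the induction hypothesis applies; this
  is why the middle space is Euclidean.\<close>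

lemma Ck_on_compose:
  fixes f :: "'b::euclidean_space \<Rightarrow> 'c::real_normed_vector"
    and h :: "'a::real_normed_vector \<Rightarrow> 'b"
  assumes "open S" "h ` S \<subseteq> S'" "Ck_on k S' f" "Ck_on k S h"
  shows "Ck_on k S (\<lambda>x. f (h x))"
  using assms(3,4)
proof (induction k arbitrary: f)
  case 0
  then show ?case using continuous_on_compose2[of S' f S h] assms(2) by auto
next
  case (Suc k)
  let ?f' = "\<lambda>x. frechet_derivative f (at x)" and ?h' = "\<lambda>x. frechet_derivative h (at x)"
  have d: "((\<lambda>x. f (h x)) has_derivative (\<lambda>v. ?f' (h x) (?h' x v))) (at x)" if "x \<in> S" for x
    using Suc.prems that assms(2) has_derivative_compose[of h "?h' x" x UNIV f "?f' (h x)"]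
    by (auto simp: frechet_derivative_works)
  have e: "frechet_derivative (\<lambda>x. f (h x)) (at x) v = (\<Sum>i\<in>Basis. (?h' x v \<bullet> i) *\<^sub>R ?f' (h x) i)"
    if "x \<in> S" for x v
  proof -
    have "f differentiable (at (h x))" using Suc.prems(1) that assms(2) by auto
    then have lin: "linear (?f' (h x))" by (rule linear_frechet_derivative)
    have "?f' (h x) (?h' x v) = ?f' (h x) (\<Sum>i\<in>Basis. (?h' x v \<bullet> i) *\<^sub>R i)"
      by (simp add: euclidean_representation)
    also have "\<dots> = (\<Sum>i\<in>Basis. (?h' x v \<bullet> i) *\<^sub>R ?f' (h x) i)"
      by (simp only: linear_sum[OF lin] linear_scale[OF lin])
    finally show ?thesis using frechet_derivative_at[OF d[OF that]] by metis
  qed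
  have h: "Ck_on k S h" by (rule Ck_on_SucD) (rule Suc.prems)
  have "Ck_on k S (\<lambda>x. \<Sum>i\<in>Basis. (?h' x v \<bullet> i) *\<^sub>R ?f' (h x) i)" for v
    using Suc.prems
    by (intro Ck_on_sum[OF assms(1)] Ck_on_scaleR[OF assms(1)] Suc.IH[OF _ h]
        Ck_on_bounded_linear[OF assms(1) bounded_linear_inner_left]) auto
  then have "Ck_on k S (\<lambda>x. frechet_derivative (\<lambda>x. f (h x)) (at x) v)" for v
    by (rule Ck_on_cong[OF assms(1), rotated]) (simp add: e)
  then show ?case using d by (auto simp: differentiable_def)
qed

lemma smooth_on_cong:
  "open S \<Longrightarrow> (\<And>x. x \<in> S \<Longrightarrow> f x = h x) \<Longrightarrow> smooth_on S f \<Longrightarrow> smooth_on S h"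
  unfolding smooth_on_def using Ck_on_cong by metis

lemma smooth_on_subset: "smooth_on S f \<Longrightarrow> S' \<subseteq> S \<Longrightarrow> smooth_on S' f"
  unfolding smooth_on_def using Ck_on_subset by metis

lemma smooth_on_add: "open S \<Longrightarrow> smooth_on S f \<Longrightarrow> smooth_on S h \<Longrightarrow> smooth_on S (\<lambda>x. f x + h x)"
  unfolding smooth_on_def using Ck_on_add by metis

lemma smooth_on_scaleR:
  fixes f :: "'a::real_normed_vector \<Rightarrow> real"
  shows "open S \<Longrightarrow> smooth_on S f \<Longrightarrow> smooth_on S h \<Longrightarrow> smooth_on S (\<lambda>x. f x *\<^sub>R h x)"
  unfolding smooth_on_def using Ck_on_scaleR by metis

lemma smooth_on_const: "smooth_on S (\<lambda>x. c)"
  by (simp add: smooth_on_def Ck_on_const)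

lemma smooth_on_compose:
  fixes f :: "'b::euclidean_space \<Rightarrow> 'c::real_normed_vector"
  shows "open S \<Longrightarrow> h ` S \<subseteq> S' \<Longrightarrow> smooth_on S' f \<Longrightarrow> smooth_on S h \<Longrightarrow> smooth_on S (\<lambda>x. f (h x))"
  unfolding smooth_on_def using Ck_on_compose by metis

lemma smooth_on_frechet_derivative: "smooth_on S f \<Longrightarrow> smooth_on S (\<lambda>x. frechet_derivative f (at x) v)"
  unfolding smooth_on_def by (metis Ck_on.simps(2))

lemma smooth_on_differentiable: "smooth_on S f \<Longrightarrow> x \<in> S \<Longrightarrow> f differentiable (at x)"
  unfolding smooth_on_def by (metis Ck_on.simps(2))

section \<open>Para-quaternionic linear algebra\<close>

lemma linear_on_subspaceI:
  assumes "\<And>x y. x \<in> T \<Longrightarrow> y \<in> T \<Longrightarrow> f (x + y) = f x + f y"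
    and "\<And>x r. x \<in> T \<Longrightarrow> f (r *\<^sub>R x) = r *\<^sub>R f x"
  shows "linear_on_subspace T f"
  using assms by (simp add: linear_on_subspace_def)

lemma
  assumes "linear_on_subspace T f" "subspace T"
  shows linear_on_subspace_add: "x \<in> T \<Longrightarrow> y \<in> T \<Longrightarrow> f (x + y) = f x + f y"
    and linear_on_subspace_scaleR: "x \<in> T \<Longrightarrow> f (r *\<^sub>R x) = r *\<^sub>R f x"
    and linear_on_subspace_minus: "x \<in> T \<Longrightarrow> f (- x) = - f x"
    and linear_on_subspace_diff: "x \<in> T \<Longrightarrow> y \<in> T \<Longrightarrow> f (x - y) = f x - f y"
    and linear_on_subspace_zero: "f 0 = 0"
proof -
  show a: "x \<in> T \<Longrightarrow> y \<in> T \<Longrightarrow> f (x + y) = f x + f y" for x y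
    using assms(1) by (auto simp: linear_on_subspace_def)
  show s: "x \<in> T \<Longrightarrow> f (r *\<^sub>R x) = r *\<^sub>R f x" for x r
    using assms(1) by (auto simp: linear_on_subspace_def)
  show m: "x \<in> T \<Longrightarrow> f (- x) = - f x" for x
    using s[of x "- 1"] by simp
  show "x \<in> T \<Longrightarrow> y \<in> T \<Longrightarrow> f (x - y) = f x - f y" for x y
    using a[of x "- y"] m[of y] subspace_neg[OF assms(2)] by simp
  show "f 0 = 0"
    using s[of 0 0] subspace_0[OF assms(2)] by simp
qed

section \<open>Nondegenerate symmetric bilinear forms on a subspace\<close>

locale pseudo_euclidean =
  fixes T :: "'a::real_vector set" and g :: "'a \<Rightarrow> 'a \<Rightarrow> real"
  assumes T: "subspace T"
    and g_linear: "x \<in> T \<Longrightarrow> linear_on_subspace T (g x)"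
    and g_sym: "x \<in> T \<Longrightarrow> y \<in> T \<Longrightarrow> g x y = g y x"
    and g_nondegenerate: "x \<in> T \<Longrightarrow> (\<And>y. y \<in> T \<Longrightarrow> g x y = 0) \<Longrightarrow> x = 0"
begin

lemma in_T [simp]:
  "x \<in> T \<Longrightarrow> y \<in> T \<Longrightarrow> x + y \<in> T"
  "x \<in> T \<Longrightarrow> y \<in> T \<Longrightarrow> x - y \<in> T"
  "x \<in> T \<Longrightarrow> - x \<in> T"
  "x \<in> T \<Longrightarrow> r *\<^sub>R x \<in> T"
  "0 \<in> T"
  using T by (auto intro: subspace_add subspace_diff subspace_neg subspace_scale subspace_0)

lemma g_right [simp]:
  assumes "x \<in> T" "y \<in> T"
  shows "z \<in> T \<Longrightarrow> g x (y + z) = g x y + g x z"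
    and "z \<in> T \<Longrightarrow> g x (y - z) = g x y - g x z"
    and "g x (- y) = - g x y"
    and "g x (r *\<^sub>R y) = r * g x y"
  using linear_on_subspace_add[OF g_linear T] linear_on_subspace_diff[OF g_linear T]
    linear_on_subspace_minus[OF g_linear T] linear_on_subspace_scaleR[OF g_linear T] assms
  by simp_all

lemma g_left [simp]:
  assumes "x \<in> T" "y \<in> T"
  shows "z \<in> T \<Longrightarrow> g (y + z) x = g y x + g z x"
    and "z \<in> T \<Longrightarrow> g (y - z) x = g y x - g z x"
    and "g (- y) x = - g y x"
    and "g (r *\<^sub>R y) x = r * g y x"
  using assms by (simp_all add: g_sym[of _ x])

lemma g_0 [simp]: "x \<in> T \<Longrightarrow> g x 0 = 0" "x \<in> T \<Longrightarrow> g 0 x = 0"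
  using g_right(4)[of x 0 0] g_left(4)[of x 0 0] by simp_all

lemma eqI:
  assumes "x \<in> T" "y \<in> T" "\<And>w. w \<in> T \<Longrightarrow> g w x = g w y"
  shows "x = y"
  using g_nondegenerate[of "x - y"] assms by (simp add: g_sym[of _ "_::'a"])

text \<open>Moving \<open>A\<close> to the other argument of \<open>g\<close> exposes linearity in
  \<open>x\<close>, and nondegeneracy transfers it to \<open>A x\<close>. Linearity of covariant
  derivatives of skew fields thus comes for free.\<close>

lemma skew_imp_linear:
  assumes AB: "\<And>x. x \<in> T \<Longrightarrow> A x \<in> T"
    and skew: "\<And>x y. x \<in> T \<Longrightarrow> y \<in> T \<Longrightarrow> g (A x) y = - g x (A y)"
  shows "linear_on_subspace T A"
proof -
  have "g w (A x) = - g (A w) x" if "x \<in> T" "w \<in> T" for x w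
    using skew[of w x] that by simp
  then show ?thesis
    by (intro linear_on_subspaceI eqI) (simp_all add: AB)
qed

lemma nonnull_exists:
  assumes "v \<in> T" "v \<noteq> 0"
  obtains x where "x \<in> T" "g x x \<noteq> 0"
proof (rule ccontr)
  assume "\<not> thesis"
  with that have null: "g x x = 0" if "x \<in> T" for x using \<open>x \<in> T\<close> by blast
  \<comment> \<open>Polarisation: with all squares zero, \<open>g (v + y) (v + y)\<close> reduces to
    \<open>2 * g v y\<close>.\<close>
  have "g v y = 0" if "y \<in> T" for y
    using null[of "v + y"] null[of v] null[of y] that assms by (simp add: g_sym[of y v])
  then show False using g_nondegenerate[of v] assms by auto
qed

text \<open>Along the line \<open>x + r v\<close> with \<open>v\<close> non-null the square is a
  polynomial of degree exactly two in \<open>r\<close>, so it cannot vanish at all three of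
  \<open>1\<close>, \<open>-1\<close>, \<open>2\<close>; these values are nonzero, hence
  \<open>r v\<close> is non-null too.\<close>

lemma nonnull_difference:
  assumes x: "x \<in> T"
  obtains y where "y \<in> T" "g (x + y) (x + y) \<noteq> 0" "g y y \<noteq> 0" | "x = 0"
proof (cases "x = 0")
  case False
  obtain v where v: "v \<in> T" "g v v \<noteq> 0" using nonnull_exists x False by metis
  have exp: "g (x + r *\<^sub>R v) (x + r *\<^sub>R v) = g x x + 2 * r * g x v + r\<^sup>2 * g v v" for r
    using x v by (simp add: g_sym[of v x] power2_eq_square algebra_simps)
  have "\<exists>r\<in>{1, -1, 2}. g (x + r *\<^sub>R v) (x + r *\<^sub>R v) \<noteq> 0"
  proof (rule ccontr)
    assume "\<not> ?thesis"
    then have "g x x + 2 * g x v + g v v = 0" "g x x - 2 * g x v + g v v = 0"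
      "g x x + 4 * g x v + 4 * g v v = 0"
      unfolding exp by auto
    then show False using v by linarith
  qed
  then obtain r where r: "r \<in> {1, -1, 2}" "g (x + r *\<^sub>R v) (x + r *\<^sub>R v) \<noteq> 0" ..
  then have "r \<noteq> 0" by auto
  with v have "r *\<^sub>R v \<in> T" "g (r *\<^sub>R v) (r *\<^sub>R v) \<noteq> 0" by simp_all
  with r(2) show ?thesis by (intro that(1))
qed (use that in blast)

end

section \<open>Para-quaternionic triples of skew operators\<close>

locale para_quaternionic_hermitian = pseudo_euclidean T g
  for T :: "'a::real_vector set" and g :: "'a \<Rightarrow> 'a \<Rightarrow> real" +
  fixes I J K :: "'a \<Rightarrow> 'a"
  assumes IJK_linear: "linear_on_subspace T I" "linear_on_subspace T J" "linear_on_subspace T K"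
    and IJK_in [simp]: "x \<in> T \<Longrightarrow> I x \<in> T" "x \<in> T \<Longrightarrow> J x \<in> T" "x \<in> T \<Longrightarrow> K x \<in> T"
    and skew [simp]:
      "x \<in> T \<Longrightarrow> y \<in> T \<Longrightarrow> g (I x) y = - g x (I y)"
      "x \<in> T \<Longrightarrow> y \<in> T \<Longrightarrow> g (J x) y = - g x (J y)"
      "x \<in> T \<Longrightarrow> y \<in> T \<Longrightarrow> g (K x) y = - g x (K y)"
    and relations: "para_quaternion_relations T I J K"
begin

lemma rel [simp]:
  assumes "x \<in> T"
  shows "I (I x) = - x" "J (J x) = x" "K (K x) = x" "I (J x) = K x" "J (I x) = - K x"
    "J (K x) = - I x" "K (J x) = I x" "K (I x) = J x" "I (K x) = - J x"
  using relations assms by (simp_all add: para_quaternion_relations_def)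

lemma IJK_lin [simp]:
  assumes "x \<in> T"
  shows "y \<in> T \<Longrightarrow> I (x + y) = I x + I y" "y \<in> T \<Longrightarrow> J (x + y) = J x + J y"
    "y \<in> T \<Longrightarrow> K (x + y) = K x + K y"
    "y \<in> T \<Longrightarrow> I (x - y) = I x - I y" "y \<in> T \<Longrightarrow> J (x - y) = J x - J y"
    "y \<in> T \<Longrightarrow> K (x - y) = K x - K y"
    "I (- x) = - I x" "J (- x) = - J x" "K (- x) = - K x"
    "I (r *\<^sub>R x) = r *\<^sub>R I x" "J (r *\<^sub>R x) = r *\<^sub>R J x" "K (r *\<^sub>R x) = r *\<^sub>R K x"
  using assms IJK_linear[THEN linear_on_subspace_add[OF _ T]]
    IJK_linear[THEN linear_on_subspace_diff[OF _ T]]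
    IJK_linear[THEN linear_on_subspace_minus[OF _ T]]
    IJK_linear[THEN linear_on_subspace_scaleR[OF _ T]]
  by simp_all

lemma g_self [simp]: "x \<in> T \<Longrightarrow> g x (I x) = 0" "x \<in> T \<Longrightarrow> g x (J x) = 0" "x \<in> T \<Longrightarrow> g x (K x) = 0"
proof -
  assume x: "x \<in> T"
  have "g x (A x) = 0" if "A x \<in> T" "g (A x) x = - g x (A x)" for A
    using that(2) g_sym[OF x that(1)] by linarith
  from this[of I] this[of J] this[of K] x
  show "g x (I x) = 0" "g x (J x) = 0" "g x (K x) = 0" by simp_all
qed

text \<open>The operators that are Hermitian over the para-quaternions. This is all that is known at
  first about \<open>P\<close>, \<open>Q\<close>, \<open>R\<close>. Composition with
  \<open>I\<close>, \<open>J\<close> or \<open>K\<close> makes them skew, whence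
  \<open>csym_self\<close>.\<close>

definition csym :: "('a \<Rightarrow> 'a) \<Rightarrow> bool"
  where "csym S \<longleftrightarrow> (\<forall>x\<in>T. S x \<in> T \<and> S (I x) = I (S x) \<and> S (J x) = J (S x) \<and> S (K x) = K (S x)) \<and>
    linear_on_subspace T S \<and> (\<forall>x\<in>T. \<forall>y\<in>T. g (S x) y = g x (S y))"

lemma csymD:
  assumes "csym S" "x \<in> T"
  shows "S x \<in> T" "I (S x) = S (I x)" "J (S x) = S (J x)" "K (S x) = S (K x)"
    "y \<in> T \<Longrightarrow> S (x + y) = S x + S y" "S (- x) = - S x" "S (r *\<^sub>R x) = r *\<^sub>R S x"
    "y \<in> T \<Longrightarrow> g (S x) y = g x (S y)"
proof -
  have "linear_on_subspace T S" using assms(1) by (simp add: csym_def)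
  from linear_on_subspace_add[OF this T] linear_on_subspace_scaleR[OF this T]
    linear_on_subspace_minus[OF this T] assms
  show "S x \<in> T" "I (S x) = S (I x)" "J (S x) = S (J x)" "K (S x) = S (K x)"
    "y \<in> T \<Longrightarrow> S (x + y) = S x + S y" "S (- x) = - S x" "S (r *\<^sub>R x) = r *\<^sub>R S x"
    "y \<in> T \<Longrightarrow> g (S x) y = g x (S y)"
    by (simp_all add: csym_def)
qed

lemma csym_flip: "csym S \<Longrightarrow> x \<in> T \<Longrightarrow> y \<in> T \<Longrightarrow> g x (S y) = g y (S x)"
  using csymD(8)[of S x y] csymD(1)[of S x] g_sym[of "S x" y] by simp

lemma csym_self:
  assumes "csym S" "x \<in> T"
  shows "g x (S (I x)) = 0" "g x (S (J x)) = 0" "g x (S (K x)) = 0"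
  using csym_flip[OF assms, of "I x"] csym_flip[OF assms, of "J x"] csym_flip[OF assms, of "K x"]
    csymD[OF assms(1)] assms by simp_all

text \<open>The orthogonal complement of the span of \<open>x, I x, J x, K x\<close>. Placing the
  units on \<open>u\<close> rather than on \<open>x\<close> changes only signs and makes stability
  under \<open>I\<close>, \<open>J\<close>, \<open>K\<close> immediate.\<close>

definition perp :: "'a \<Rightarrow> 'a \<Rightarrow> bool"
  where "perp x u \<longleftrightarrow> u \<in> T \<and> g x u = 0 \<and> g x (I u) = 0 \<and> g x (J u) = 0 \<and> g x (K u) = 0"

lemma perpD:
  assumes "perp x u" "x \<in> T"
  shows "u \<in> T" "g x u = 0" "g x (I u) = 0" "g x (J u) = 0" "g x (K u) = 0"
    "g u x = 0" "g u (I x) = 0" "g u (J x) = 0" "g u (K x) = 0"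
  using assms skew[of x u] g_sym[of u x] g_sym[of u "I x"] g_sym[of u "J x"] g_sym[of u "K x"]
  by (auto simp: perp_def)

lemma perp_IJK: "perp x u \<Longrightarrow> x \<in> T \<Longrightarrow> perp x (I u)" "perp x u \<Longrightarrow> x \<in> T \<Longrightarrow> perp x (J u)"
    "perp x u \<Longrightarrow> x \<in> T \<Longrightarrow> perp x (K u)"
  by (auto simp: perp_def)

lemma decomposition:
  assumes x: "x \<in> T" "g x x \<noteq> 0" and z: "z \<in> T"
  obtains u a b c d where "perp x u" "z = u + a *\<^sub>R x + b *\<^sub>R I x + c *\<^sub>R J x + d *\<^sub>R K x"
proof -
  define n where "n = g x x"
  \<comment> \<open>The vectors \<open>x, I x, J x, K x\<close> are orthogonal with squares
    \<open>n, n, -n, -n\<close>. Moving a unit from \<open>x\<close> to \<open>z\<close> costs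
    another sign, which leaves the minus at \<open>b\<close> alone.\<close>
  define a b c d where "a = g x z / n" "b = - g x (I z) / n" "c = g x (J z) / n" "d = g x (K z) / n"
  note abcd = this
  define u where "u = z - (a *\<^sub>R x + b *\<^sub>R I x + c *\<^sub>R J x + d *\<^sub>R K x)"
  have "n \<noteq> 0" using x n_def by simp
  then have "perp x u"
    using x z unfolding perp_def u_def abcd by (simp flip: n_def)
  moreover have "z = u + a *\<^sub>R x + b *\<^sub>R I x + c *\<^sub>R J x + d *\<^sub>R K x"
    by (simp add: u_def)
  ultimately show thesis by (rule that)
qed

text \<open>Both \<open>S x\<close> and \<open>S u\<close> are tested against a vector split by
  \<open>decomposition\<close>. The components along \<open>I x\<close>, \<open>J x\<close>,
  \<open>K x\<close> contribute nothing because of \<open>csym_self\<close> or \<open>mixed\<close>,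
  so \<open>S\<close> acts by the same ratio on \<open>x\<close> and on its complement, and by
  commutation on all of \<open>T\<close>.\<close>

lemma csym_scalar:
  assumes S: "csym S" and x: "x \<in> T" "g x x \<noteq> 0"
    and mixed: "\<And>u. perp x u \<Longrightarrow> g x (S u) = 0"
    and block: "\<And>u w. perp x u \<Longrightarrow> perp x w \<Longrightarrow> g x x * g w (S u) = g x (S x) * g w u"
    and z: "z \<in> T"
  shows "S z = (g x (S x) / g x x) *\<^sub>R z"
proof -
  define r where "r = g x (S x) / g x x"
  note S' = csymD[OF S] csym_self[OF S]
  have Su: "S u = r *\<^sub>R u" if u: "perp x u" for u
  proof (rule eqI)
    note u' = perpD[OF u x(1)] u[THEN perp_IJK(1), OF x(1)] u[THEN perp_IJK(2), OF x(1)]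
      u[THEN perp_IJK(3), OF x(1)]
    show "S u \<in> T" "r *\<^sub>R u \<in> T" using u' S' by auto
    fix w assume "w \<in> T"
    then obtain v a b c d where v: "perp x v" "w = v + a *\<^sub>R x + b *\<^sub>R I x + c *\<^sub>R J x + d *\<^sub>R K x"
      using decomposition x by blast
    have "g v (S u) = r * g v u" using block[OF u v(1)] x by (simp add: r_def field_simps)
    then show "g w (S u) = g w (r *\<^sub>R u)"
      using v(2) perpD[OF v(1) x(1)] u u' x S' mixed by simp
  qed
  have Sx: "S x = r *\<^sub>R x"
  proof (rule eqI)
    show "S x \<in> T" "r *\<^sub>R x \<in> T" using x S' by auto
    fix w assume "w \<in> T"
    then obtain v a b c d where v: "perp x v" "w = v + a *\<^sub>R x + b *\<^sub>R I x + c *\<^sub>R J x + d *\<^sub>R K x"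
      using decomposition x by blast
    have "g v (S x) = 0" using mixed[OF v(1)] csym_flip[OF S x(1) perpD(1)[OF v(1) x(1)]] by simp
    then show "g w (S x) = g w (r *\<^sub>R x)"
      using v(2) perpD[OF v(1) x(1)] x S' by (simp add: r_def)
  qed
  obtain u a b c d where u: "perp x u" "z = u + a *\<^sub>R x + b *\<^sub>R I x + c *\<^sub>R J x + d *\<^sub>R K x"
    using decomposition x z by blast
  show ?thesis
    using Su[OF u(1)] Sx x perpD(1)[OF u(1) x(1)] S' unfolding u(2)
    by (simp add: scaleR_add_right flip: r_def S'(2-4)) (simp add: mult.commute)
qed

text \<open>The value at \<open>(x, y, z, w)\<close> of the sum over \<open>A = I, J, K\<close> of \<open>\<plusminus> \<Omega>\<^sub>A \<and> g(\<sqdot>, A'\<sqdot>)\<close>, up to a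
  positive factor; \<open>A'\<close> plays the role of the covariant derivative of \<open>A\<close>.\<close>

definition dform :: "('a \<Rightarrow> 'a) \<Rightarrow> ('a \<Rightarrow> 'a) \<Rightarrow> ('a \<Rightarrow> 'a) \<Rightarrow> 'a \<Rightarrow> 'a \<Rightarrow> 'a \<Rightarrow> 'a \<Rightarrow> real"
  where "dform I' J' K' x y z w =
    (let s = \<lambda>A A'. g x (A' y) * g z (A w) + g x (A y) * g z (A' w)
                  + g x (A' z) * g w (A y) + g x (A z) * g w (A' y)
                  + g x (A' w) * g y (A z) + g x (A w) * g y (A' z)
     in s I I' - s J J' - s K K')"

section \<open>The nearly parallel equation in a non-null direction\<close>

lemma dform_zero_scalar:
  assumes csym: "csym P" "csym Q" "csym R"
    and I': "\<And>z. z \<in> T \<Longrightarrow> I' z = 2 *\<^sub>R (R (J z) - Q (K z))"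
    and J': "\<And>z. z \<in> T \<Longrightarrow> J' z = 2 *\<^sub>R (P (K z) + R (I z))"
    and K': "\<And>z. z \<in> T \<Longrightarrow> K' z = - 2 *\<^sub>R (P (J z) + Q (I z))"
    and x: "x \<in> T" "g x x \<noteq> 0"
    and zero: "\<And>y z w. y \<in> T \<Longrightarrow> z \<in> T \<Longrightarrow> w \<in> T \<Longrightarrow> dform I' J' K' x y z w = 0"
  obtains p q r where "\<And>z. z \<in> T \<Longrightarrow> P z = p *\<^sub>R z" "\<And>z. z \<in> T \<Longrightarrow> Q z = q *\<^sub>R z"
    "\<And>z. z \<in> T \<Longrightarrow> R z = r *\<^sub>R z"
proof -
  note C = csymD[OF csym(1)] csymD[OF csym(2)] csymD[OF csym(3)]
    csym_self[OF csym(1)] csym_self[OF csym(2)] csym_self[OF csym(3)]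
  note simps = C I' J' K' x(1)
  define n where "n = g x x"
  have n: "n \<noteq> 0" using x n_def by simp
  have mixed: "g x (P u) = 0 \<and> g x (Q u) = 0 \<and> g x (R u) = 0" if u: "perp x u" for u
  proof -
    have rels: "g x (R u) + g x (Q (I u)) + g x (P (J u)) = 0"
      "g x (P u) + g x (R (J u)) - g x (Q (K u)) = 0"
      "g x (Q u) - g x (P (K u)) - g x (R (I u)) = 0" if u: "perp x u" for u
    proof -
      have m: "g u (P w) = g w (P u)" "g u (Q w) = g w (Q u)" "g u (R w) = g w (R u)" if "w \<in> T" for w
        using that csym_flip[OF csym(1)] csym_flip[OF csym(2)] csym_flip[OF csym(3)] perpD(1)[OF u x(1)] by auto
      note u' = perpD[OF u x(1)]
      have "n * (g x (R u) + g x (Q (I u)) + g x (P (J u))) = 0"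
        using zero[of "I x" "J x" u] u' by (simp add: dform_def Let_def simps m n_def algebra_simps)
      then show "g x (R u) + g x (Q (I u)) + g x (P (J u)) = 0" using n by simp
      have "n * (g x (P u) + g x (R (J u)) - g x (Q (K u))) = 0"
        using zero[of "J x" "K x" u] u' by (simp add: dform_def Let_def simps m n_def algebra_simps)
      then show "g x (P u) + g x (R (J u)) - g x (Q (K u)) = 0" using n by simp
      have "n * (g x (Q u) - g x (P (K u)) - g x (R (I u))) = 0"
        using zero[of "K x" "I x" u] u' by (simp add: dform_def Let_def simps m n_def algebra_simps)
      then show "g x (Q u) - g x (P (K u)) - g x (R (I u)) = 0" using n by simp
    qed
    note u' = perpD[OF u x(1)]
    \<comment> \<open>Twelve linear equations in the twelve numbers \<open>g x (S (A u))\<close>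
      with \<open>S\<close> one of \<open>P, Q, R\<close> and \<open>A\<close> the identity or a
      unit. For example, the first relation at \<open>J u\<close> minus the second at
      \<open>u\<close> gives \<open>2 * g x (Q (K u)) = 0\<close>; with \<open>Q\<close> gone, the
      third then removes \<open>R\<close> and \<open>P\<close>.\<close>
    show ?thesis
      using rels[OF u] rels[OF perp_IJK(1)[OF u x(1)]] rels[OF perp_IJK(2)[OF u x(1)]]
        rels[OF perp_IJK(3)[OF u x(1)]] u'
      by (simp add: simps)
  qed
  \<comment> \<open>The last argument is taken to be \<open>J u\<close> because
    \<open>I' (J u)\<close> is \<open>2 (R u - Q (I u))\<close>, and it meets the factor
    \<open>g x (I (I x)) = - n\<close>.\<close>
  have block1: "n * (g w (R u) - g w (Q (I u))) = g x (R x) * g w u - g x (Q x) * g w (I u)"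
    if u: "perp x u" and w: "perp x w" for u w
  proof -
    note u' = perpD[OF u x(1)] and w' = perpD[OF w x(1)]
    show ?thesis
      using zero[of "I x" w "J u"] u' w' mixed[OF u] mixed[OF w]
      by (simp add: dform_def Let_def simps n_def algebra_simps)
  qed
  have block2: "n * (g w (P u) - g w (R (J u))) = g x (P x) * g w u - g x (R x) * g w (J u)"
    if u: "perp x u" and w: "perp x w" for u w
  proof -
    note u' = perpD[OF u x(1)] and w' = perpD[OF w x(1)]
    show ?thesis
      using zero[of "J x" w "K u"] u' w' mixed[OF u] mixed[OF w]
      by (simp add: dform_def Let_def simps n_def algebra_simps)
  qed
  have swap: "g w u = g u w" "g w (S u) = g u (S w)" "g w (I u) = - g u (I w)"
      "g w (J u) = - g u (J w)" "g w (S (I u)) = - g u (S (I w))" "g w (S (J u)) = - g u (S (J w))"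
    if "csym S" "perp x u" "perp x w" for S u w
  proof -
    have T: "u \<in> T" "w \<in> T" using that perpD(1) x(1) by auto
    note S' = csymD[OF that(1)]
    show "g w u = g u w" "g w (S u) = g u (S w)" using T csym_flip[OF that(1)] g_sym by auto
    show "g w (I u) = - g u (I w)" "g w (J u) = - g u (J w)"
      using T g_sym[of w "I u"] g_sym[of w "J u"] by auto
    show "g w (S (I u)) = - g u (S (I w))" "g w (S (J u)) = - g u (S (J w))"
      using T csym_flip[OF that(1), of w "I u"] csym_flip[OF that(1), of w "J u"] S' by auto
  qed
  \<comment> \<open>Exchanging \<open>u\<close> and \<open>w\<close> fixes the terms in
    \<open>R u\<close> and \<open>u\<close> and reverses those in \<open>Q (I u)\<close> and
    \<open>I u\<close>; adding the two instances isolates \<open>R\<close>.\<close>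
  have blockR: "n * g w (R u) = g x (R x) * g w u" if u: "perp x u" and w: "perp x w" for u w
    using block1[OF u w] block1[OF w u] unfolding swap[OF csym(3) u w] swap[OF csym(2) u w]
    by (simp add: algebra_simps)
  \<comment> \<open>With the \<open>R\<close> part known, the skew part of \<open>block1\<close>
    remains; replacing \<open>u\<close> by \<open>I u\<close> turns \<open>Q (I u)\<close> into
    \<open>- Q u\<close>.\<close>
  have blockQ: "n * g w (Q u) = g x (Q x) * g w u" if u: "perp x u" and w: "perp x w" for u w
    using block1[OF perp_IJK(1)[OF u x(1)] w] blockR[OF perp_IJK(1)[OF u x(1)] w]
      perpD(1)[OF u x(1)] perpD(1)[OF w x(1)]
    by (simp add: simps distrib_left)
  have blockP: "n * g w (P u) = g x (P x) * g w u" if u: "perp x u" and w: "perp x w" for u w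
    using block2[OF u w] block2[OF w u] unfolding swap[OF csym(1) u w] swap[OF csym(3) u w]
    by (simp add: algebra_simps)
  show thesis
    using csym_scalar[OF csym(1) x] csym_scalar[OF csym(2) x] csym_scalar[OF csym(3) x]
      mixed blockP blockQ blockR
    by (intro that) (auto simp flip: n_def)
qed

text \<open>The relations satisfied by the derivatives \<open>I', J', K'\<close> of a smooth family \<open>I, J, K\<close> of
  para-quaternionic triples.\<close>

definition infinitesimal_variation :: "('a \<Rightarrow> 'a) \<Rightarrow> ('a \<Rightarrow> 'a) \<Rightarrow> ('a \<Rightarrow> 'a) \<Rightarrow> bool"
  where "infinitesimal_variation I' J' K' \<longleftrightarrow>
    (\<forall>A\<in>{I', J', K'}. \<forall>x\<in>T. A x \<in> T \<and> (\<forall>y\<in>T. g (A x) y = - g x (A y))) \<and>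
    (\<forall>x\<in>T. I' (I x) = - I (I' x) \<and> J' (J x) = - J (J' x) \<and> K' (K x) = - K (K' x) \<and>
       K' x = I' (J x) + I (J' x) \<and> K' x = - J' (I x) - J (I' x))"

section \<open>First-order variation of a para-quaternionic triple\<close>

lemma infinitesimal_variationI:
  assumes "\<And>A x. A \<in> {I', J', K'} \<Longrightarrow> x \<in> T \<Longrightarrow> A x \<in> T"
    and "\<And>A x y. A \<in> {I', J', K'} \<Longrightarrow> x \<in> T \<Longrightarrow> y \<in> T \<Longrightarrow> g (A x) y = - g x (A y)"
    and "\<And>x. x \<in> T \<Longrightarrow> I' (I x) = - I (I' x)" "\<And>x. x \<in> T \<Longrightarrow> J' (J x) = - J (J' x)"
      "\<And>x. x \<in> T \<Longrightarrow> K' (K x) = - K (K' x)"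
    and "\<And>x. x \<in> T \<Longrightarrow> K' x = I' (J x) + I (J' x)" "\<And>x. x \<in> T \<Longrightarrow> K' x = - J' (I x) - J (I' x)"
  shows "infinitesimal_variation I' J' K'"
  unfolding infinitesimal_variation_def by (intro conjI ballI) (rule assms; assumption)+

text \<open>An anticommutator with a unit commutes with that unit, since the square of the unit is a
  scalar. Differentiating \<open>I J + J I = 0\<close> equates \<open>I' J + J I'\<close> with
  \<open>- (J' I + I J')\<close>, so \<open>R\<close> commutes with \<open>J\<close> and with
  \<open>I\<close>; the other two pairs of units serve \<open>Q\<close> and \<open>P\<close>.
  Symmetry holds because an anticommutator of skew operators is symmetric.\<close>

lemma infinitesimal_variation_decomposition:
  assumes var: "infinitesimal_variation I' J' K'"
  obtains P Q R where "csym P" "csym Q" "csym R"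
    "\<And>z. z \<in> T \<Longrightarrow> I' z = 2 *\<^sub>R (R (J z) - Q (K z))"
    "\<And>z. z \<in> T \<Longrightarrow> J' z = 2 *\<^sub>R (P (K z) + R (I z))"
    "\<And>z. z \<in> T \<Longrightarrow> K' z = - 2 *\<^sub>R (P (J z) + Q (I z))"
proof -
  have inT: "x \<in> T \<Longrightarrow> I' x \<in> T" "x \<in> T \<Longrightarrow> J' x \<in> T" "x \<in> T \<Longrightarrow> K' x \<in> T" for x
    using var by (auto simp: infinitesimal_variation_def)
  have sk: "x \<in> T \<Longrightarrow> y \<in> T \<Longrightarrow> g (I' x) y = - g x (I' y)"
    "x \<in> T \<Longrightarrow> y \<in> T \<Longrightarrow> g (J' x) y = - g x (J' y)"
    "x \<in> T \<Longrightarrow> y \<in> T \<Longrightarrow> g (K' x) y = - g x (K' y)" for x y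
    using var by (auto simp: infinitesimal_variation_def)
  note lin = skew_imp_linear[OF inT(1) sk(1)] skew_imp_linear[OF inT(2) sk(2)] skew_imp_linear[OF inT(3) sk(3)]
  note lin' = lin[THEN linear_on_subspace_add[OF _ T]] lin[THEN linear_on_subspace_scaleR[OF _ T]]
    lin[THEN linear_on_subspace_minus[OF _ T]] lin[THEN linear_on_subspace_diff[OF _ T]]
  have sq: "I' (I x) = - I (I' x)" "J' (J x) = - J (J' x)" "K' (K x) = - K (K' x)" if "x \<in> T" for x
    using var that unfolding infinitesimal_variation_def by blast+
  have K'1: "K' x = I' (J x) + I (J' x)" if "x \<in> T" for x
    using var that unfolding infinitesimal_variation_def by blast
  have K'2: "K' x = - J' (I x) - J (I' x)" if "x \<in> T" for x
    using var that unfolding infinitesimal_variation_def by blast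
  \<comment> \<open>Found by solving the desired formulas: \<open>I' = 2 (R J - Q K)\<close> forces
    \<open>I' J + J I' = 4 R\<close> and \<open>I' K + K I' = - 4 Q\<close>, and
    \<open>J' = 2 (P K + R I)\<close> forces \<open>J' K + K J' = 4 P\<close>.\<close>
  define P Q R where "P = (\<lambda>z. (1/4) *\<^sub>R (J' (K z) + K (J' z)))"
    and "Q = (\<lambda>z. - (1/4) *\<^sub>R (I' (K z) + K (I' z)))"
    and "R = (\<lambda>z. (1/4) *\<^sub>R (I' (J z) + J (I' z)))"
  note PQR = this
  have R2: "R z = - (1/4) *\<^sub>R (J' (I z) + I (J' z))" if "z \<in> T" for z
  proof -
    have "I' (J z) + J (I' z) = - (J' (I z) + I (J' z))"
      using K'1[OF that] K'2[OF that] by (simp add: algebra_simps add_eq_0_iff)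
    then show ?thesis unfolding PQR by (simp only: scaleR_minus_left scaleR_minus_right)
  qed
  \<comment> \<open>The differentiated form of \<open>I K + K I = 0\<close>, assembled from the two
    expressions for \<open>K'\<close>.\<close>
  have Q2: "Q z = (1/4) *\<^sub>R (I (K' z) + K' (I z))" if "z \<in> T" for z
  proof -
    have "K' (I z) = - I' (K z) + I (J' (I z))" using K'1[of "I z"] that by (simp add: lin')
    moreover have "I (K' z) = - I (J' (I z)) - K (I' z)" using K'2[of z] that by (simp add: inT)
    ultimately have "I (K' z) + K' (I z) = - (I' (K z) + K (I' z))" by simp
    then show ?thesis unfolding PQR by (simp only: scaleR_minus_left scaleR_minus_right)
  qed
  have P2: "P z = - (1/4) *\<^sub>R (J (K' z) + K' (J z))" if "z \<in> T" for z
  proof -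
    have "J' (K z) = - J' (J (I z))" using that by (simp add: lin')
    also have "\<dots> = J (J' (I z))" using sq(2)[OF IJK_in(1)[OF that]] by (simp only: minus_minus)
    finally have "J' (K z) = J (J' (I z))" .
    then have "J (K' z) = - J' (K z) - I' z" using K'2[of z] that by (simp add: inT)
    moreover have "K' (J z) = I' z - K (J' z)" using K'1[of "J z"] that by (simp add: sq inT)
    ultimately have "J (K' z) + K' (J z) = - (J' (K z) + K (J' z))" by simp
    then show ?thesis unfolding PQR by (simp only: scaleR_minus_left scaleR_minus_right minus_minus)
  qed
  have csymI: "csym S" if "\<And>x. x \<in> T \<Longrightarrow> S x \<in> T" "\<And>x y. x \<in> T \<Longrightarrow> y \<in> T \<Longrightarrow> g (S x) y = g x (S y)"
    "\<And>x. x \<in> T \<Longrightarrow> S (I x) = I (S x) \<and> S (J x) = J (S x) \<and> S (K x) = K (S x)" for S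
  proof -
    have "g w (S x) = g (S w) x" if "x \<in> T" "w \<in> T" for x w
      using \<open>\<And>x y. x \<in> T \<Longrightarrow> y \<in> T \<Longrightarrow> g (S x) y = g x (S y)\<close>[of w x] that by simp
    then have "linear_on_subspace T S"
      by (intro linear_on_subspaceI eqI) (simp_all add: that(1))
    with that show ?thesis by (simp add: csym_def)
  qed
  have "csym R"
  proof (rule csymI)
    have RI: "R (I x) = I (R x)" if "x \<in> T" for x
      using that by (simp add: R2 inT lin' algebra_simps)
    have RJ: "R (J x) = J (R x)" if "x \<in> T" for x
      using that by (simp add: PQR inT lin' algebra_simps)
    show inR: "R x \<in> T" if "x \<in> T" for x using that by (simp add: PQR inT)
    show "R (I x) = I (R x) \<and> R (J x) = J (R x) \<and> R (K x) = K (R x)" if "x \<in> T" for x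
      \<comment> \<open>Commutation with the third unit follows because it is the product of the
        other two.\<close>
      using RI[of x] RJ[of x] RI[of "J x"] that inR by simp
    show "g (R x) y = g x (R y)" if "x \<in> T" "y \<in> T" for x y
      using that by (simp add: PQR inT sk)
  qed
  moreover have "csym Q"
  proof (rule csymI)
    have QI: "Q (I x) = I (Q x)" if "x \<in> T" for x
      using that by (simp add: Q2 inT lin' algebra_simps)
    have QK: "Q (K x) = K (Q x)" if "x \<in> T" for x
      using that by (simp add: PQR inT lin' algebra_simps)
    show inQ: "Q x \<in> T" if "x \<in> T" for x using that by (simp add: PQR inT)
    show "Q (I x) = I (Q x) \<and> Q (J x) = J (Q x) \<and> Q (K x) = K (Q x)" if "x \<in> T" for x
      using QI[of x] QK[of x] QK[of "I x"] that inQ by simp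
    show "g (Q x) y = g x (Q y)" if "x \<in> T" "y \<in> T" for x y
      using that by (simp add: PQR inT sk)
  qed
  moreover have "csym P"
  proof (rule csymI)
    have PJ: "P (J x) = J (P x)" if "x \<in> T" for x
      using that by (simp add: P2 inT lin' algebra_simps)
    have PK: "P (K x) = K (P x)" if "x \<in> T" for x
      using that by (simp add: PQR inT lin' algebra_simps)
    show inP: "P x \<in> T" if "x \<in> T" for x using that by (simp add: PQR inT)
    show "P (I x) = I (P x) \<and> P (J x) = J (P x) \<and> P (K x) = K (P x)" if "x \<in> T" for x
      using PJ[of x] PK[of x] PK[of "J x"] that inP by simp
    show "g (P x) y = g x (P y)" if "x \<in> T" "y \<in> T" for x y
      using that by (simp add: PQR inT sk)
  qed
  moreover have "I' z = 2 *\<^sub>R (R (J z) - Q (K z))" if "z \<in> T" for z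
  proof -
    \<comment> \<open>Since \<open>K = I J\<close> and \<open>I'\<close> anticommutes with
      \<open>I\<close>, the cross terms \<open>J I' J\<close> and \<open>K I' K\<close> are opposite
      and cancel in \<open>R J - Q K\<close>.\<close>
    have "I' (K z) = - I (I' (J z))" using sq(1)[of "J z"] that by simp
    then have "K (I' (K z)) = - J (I' (J z))" using that by (simp add: inT)
    then have "R (J z) - Q (K z) = (1/2) *\<^sub>R I' z"
      using that by (simp add: PQR inT scaleR_add_right flip: scaleR_add_left)
    then show ?thesis by simp
  qed
  moreover have "J' z = 2 *\<^sub>R (P (K z) + R (I z))" if "z \<in> T" for z
  proof -
    have "J' (K z) = J (J' (I z))" using sq(2)[of "I z"] that by (simp add: lin')
    then have "K (J' (K z)) = I (J' (I z))" using that by (simp add: inT)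
    then have "P (K z) + R (I z) = (1/2) *\<^sub>R J' z"
      using that by (simp add: PQR(1) R2 inT lin' scaleR_add_right scaleR_diff_right flip: scaleR_add_left)
    then show ?thesis by simp
  qed
  moreover have "K' z = - 2 *\<^sub>R (P (J z) + Q (I z))" if "z \<in> T" for z
  proof -
    have "K' (J z) = - K (K' (I z))" using sq(3)[of "I z"] that by simp
    then have "J (K' (J z)) = I (K' (I z))" using that by (simp add: inT)
    then have "P (J z) + Q (I z) = - (1/4) *\<^sub>R K' z - (1/4) *\<^sub>R K' z"
      using that by (simp add: P2 Q2 inT lin' scaleR_add_right scaleR_diff_right)
    then have "P (J z) + Q (I z) = - (1/2) *\<^sub>R K' z"
      by (simp flip: scaleR_minus_left scaleR_diff_left)
    then show ?thesis by simp
  qed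
  ultimately show thesis using that by blast
qed

definition in_span :: "('a \<Rightarrow> 'a) \<Rightarrow> bool"
  where "in_span A \<longleftrightarrow> (\<exists>a b c. \<forall>z\<in>T. A z = a *\<^sub>R I z + b *\<^sub>R J z + c *\<^sub>R K z)"

lemma in_spanI: "(\<And>z. z \<in> T \<Longrightarrow> A z = a *\<^sub>R I z + b *\<^sub>R J z + c *\<^sub>R K z) \<Longrightarrow> in_span A"
  by (auto simp: in_span_def)

lemma in_span_diff: "in_span A \<Longrightarrow> in_span B \<Longrightarrow> (\<And>z. z \<in> T \<Longrightarrow> C z = A z - B z) \<Longrightarrow> in_span C"
proof -
  assume "in_span A" "in_span B" and C: "\<And>z. z \<in> T \<Longrightarrow> C z = A z - B z"
  then obtain a b c a' b' c' where
    "\<And>z. z \<in> T \<Longrightarrow> A z = a *\<^sub>R I z + b *\<^sub>R J z + c *\<^sub>R K z"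
    "\<And>z. z \<in> T \<Longrightarrow> B z = a' *\<^sub>R I z + b' *\<^sub>R J z + c' *\<^sub>R K z"
    unfolding in_span_def by blast
  then show "in_span C"
    by (intro in_spanI[of _ "a - a'" "b - b'" "c - c'"]) (simp add: C scaleR_diff_left)
qed

lemma nearly_parallel_nonnull:
  assumes var: "infinitesimal_variation I' J' K'"
    and x: "x \<in> T" "g x x \<noteq> 0"
    and zero: "\<And>y z w. y \<in> T \<Longrightarrow> z \<in> T \<Longrightarrow> w \<in> T \<Longrightarrow> dform I' J' K' x y z w = 0"
  shows "in_span I' \<and> in_span J' \<and> in_span K'"
proof -
  obtain P Q R where PQR: "csym P" "csym Q" "csym R"
    "\<And>z. z \<in> T \<Longrightarrow> I' z = 2 *\<^sub>R (R (J z) - Q (K z))"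
    "\<And>z. z \<in> T \<Longrightarrow> J' z = 2 *\<^sub>R (P (K z) + R (I z))"
    "\<And>z. z \<in> T \<Longrightarrow> K' z = - 2 *\<^sub>R (P (J z) + Q (I z))"
    using infinitesimal_variation_decomposition[OF var] by blast
  obtain p q r where "\<And>z. z \<in> T \<Longrightarrow> P z = p *\<^sub>R z" "\<And>z. z \<in> T \<Longrightarrow> Q z = q *\<^sub>R z"
    "\<And>z. z \<in> T \<Longrightarrow> R z = r *\<^sub>R z"
    using dform_zero_scalar[OF PQR x zero] by blast
  then show ?thesis
    by (intro conjI in_spanI[of I' 0 "2 * r" "- 2 * q"] in_spanI[of J' "2 * r" 0 "2 * p"]
        in_spanI[of K' "- 2 * q" "- 2 * p" 0]) (simp_all add: PQR(4-6) algebra_simps)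
qed

text \<open>The derivatives in direction \<open>x\<close> are those in direction
  \<open>x + y\<close> minus those in direction \<open>y\<close>, with \<open>y\<close> chosen so
  that both directions are non-null. Only membership in the span is subtracted; the scalars for the
  two directions may be unrelated.\<close>

lemma nearly_parallel:
  assumes var: "\<And>x. x \<in> T \<Longrightarrow> infinitesimal_variation (I' x) (J' x) (K' x)"
    and add: "\<And>x y z. x \<in> T \<Longrightarrow> y \<in> T \<Longrightarrow> z \<in> T \<Longrightarrow>
      I' (x + y) z = I' x z + I' y z \<and> J' (x + y) z = J' x z + J' y z \<and> K' (x + y) z = K' x z + K' y z"
    and zero: "\<And>x y z w. x \<in> T \<Longrightarrow> y \<in> T \<Longrightarrow> z \<in> T \<Longrightarrow> w \<in> T \<Longrightarrow>
      dform (I' x) (J' x) (K' x) x y z w = 0"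
    and x: "x \<in> T"
  shows "in_span (I' x) \<and> in_span (J' x) \<and> in_span (K' x)"
proof (rule nonnull_difference[OF x])
  fix y assume y: "y \<in> T" "g (x + y) (x + y) \<noteq> 0" "g y y \<noteq> 0"
  have "x + y \<in> T" using x y by simp
  note sp = nearly_parallel_nonnull[OF var[OF this] this y(2) zero[OF this]]
    nearly_parallel_nonnull[OF var[OF y(1)] y(1,3) zero[OF y(1)]]
  show ?thesis
    using sp add[OF x y(1)]
    by (auto intro: in_span_diff[of "I' (x + y)" "I' y"] in_span_diff[of "J' (x + y)" "J' y"]
        in_span_diff[of "K' (x + y)" "K' y"])
next
  assume "x = 0"
  then have "I' x z = 0" "J' x z = 0" "K' x z = 0" if "z \<in> T" for z
    using add[OF x x that] by auto
  then show ?thesis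
    by (intro conjI in_spanI[of _ 0 0 0]) simp_all
qed

section \<open>Coefficients with respect to an adapted basis\<close>

lemma anticommutators:
  assumes "\<And>z. z \<in> T \<Longrightarrow> A z = a *\<^sub>R I z + b *\<^sub>R J z + c *\<^sub>R K z" "x \<in> T"
  shows "A (I x) + I (A x) = - (2 * a) *\<^sub>R x" "A (J x) + J (A x) = (2 * b) *\<^sub>R x"
    "A (K x) + K (A x) = (2 * c) *\<^sub>R x"
  using assms by (simp_all add: algebra_simps mult_2 flip: scaleR_add_left)

text \<open>Up to the factor \<open>g y y\<close>, the coefficients are values of \<open>g\<close>.
  For a section they therefore become smooth functions of the point, even where that factor
  vanishes.\<close>

lemma span_coefficients:
  assumes "\<And>z. z \<in> T \<Longrightarrow> A z = a *\<^sub>R I z + b *\<^sub>R J z + c *\<^sub>R K z" "y \<in> T"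
  shows "g (A y) (I y) = a * g y y" "g y (A (J y)) = b * g y y" "g y (A (K y)) = c * g y y"
  using assms by simp_all

text \<open>This tensor underlies the 4-form, and its invariance expresses that a change of adapted
  basis preserves a form of signature (1,2). The nonzero vector \<open>x\<close> allows scalars to
  be compared.\<close>

lemma adapted_basis_sum:
  assumes pq: "para_quaternionic_hermitian T g I' J' K'" and nz: "x \<in> T" "x \<noteq> 0"
    and I': "\<And>z. z \<in> T \<Longrightarrow> I' z = a1 *\<^sub>R I z + b1 *\<^sub>R J z + c1 *\<^sub>R K z"
    and J': "\<And>z. z \<in> T \<Longrightarrow> J' z = a2 *\<^sub>R I z + b2 *\<^sub>R J z + c2 *\<^sub>R K z"
    and K': "\<And>z. z \<in> T \<Longrightarrow> K' z = a3 *\<^sub>R I z + b3 *\<^sub>R J z + c3 *\<^sub>R K z"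
    and I: "\<And>z. z \<in> T \<Longrightarrow> I z = p1 *\<^sub>R I' z + q1 *\<^sub>R J' z + r1 *\<^sub>R K' z"
    and J: "\<And>z. z \<in> T \<Longrightarrow> J z = p2 *\<^sub>R I' z + q2 *\<^sub>R J' z + r2 *\<^sub>R K' z"
    and K: "\<And>z. z \<in> T \<Longrightarrow> K z = p3 *\<^sub>R I' z + q3 *\<^sub>R J' z + r3 *\<^sub>R K' z"
    and T: "y \<in> T" "z \<in> T" "w \<in> T" "u \<in> T"
  shows "g y (I' z) * g w (I' u) - g y (J' z) * g w (J' u) - g y (K' z) * g w (K' u) =
    g y (I z) * g w (I u) - g y (J z) * g w (J u) - g y (K z) * g w (K u)"
proof -
  interpret B: para_quaternionic_hermitian T g I' J' K' by (rule pq)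
  \<comment> \<open>The anticommutator of a primed with an unprimed unit is a scalar that can be
    computed in either basis. The two coefficient matrices are thereby transposes of each other up
    to the signs of \<open>(1, -1, -1)\<close>.\<close>
  have "p1 = a1" "p2 = - b1" "p3 = - c1"
    using anticommutators[OF I' nz(1)] B.anticommutators(1)[OF I nz(1)]
      B.anticommutators(1)[OF J nz(1)] B.anticommutators(1)[OF K nz(1)] nz(2)
    by (simp_all add: add.commute flip: scaleR_minus_left)
  moreover have "q1 = - a2" "q2 = b2" "q3 = c2"
    using anticommutators[OF J' nz(1)] B.anticommutators(2)[OF I nz(1)]
      B.anticommutators(2)[OF J nz(1)] B.anticommutators(2)[OF K nz(1)] nz(2)
    by (simp_all add: add.commute flip: scaleR_minus_left)
  moreover have "r1 = - a3" "r2 = b3" "r3 = c3"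
    using anticommutators[OF K' nz(1)] B.anticommutators(3)[OF I nz(1)]
      B.anticommutators(3)[OF J nz(1)] B.anticommutators(3)[OF K nz(1)] nz(2)
    by (simp_all add: add.commute flip: scaleR_minus_left)
  \<comment> \<open>One factor is expanded in the primed basis and the other in the unprimed one, so
    that both sides become the same bilinear expression by the transpose relation; the orthogonality
    equations of the matrix never have to be extracted.\<close>
  moreover have "g w (I u) = p1 * g w (I' u) + q1 * g w (J' u) + r1 * g w (K' u)"
    "g w (J u) = p2 * g w (I' u) + q2 * g w (J' u) + r2 * g w (K' u)"
    "g w (K u) = p3 * g w (I' u) + q3 * g w (J' u) + r3 * g w (K' u)"
    by (simp_all only: I[OF T(4)] J[OF T(4)] K[OF T(4)]) (simp_all add: T)
  moreover have "g y (I' z) = a1 * g y (I z) + b1 * g y (J z) + c1 * g y (K z)"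
    "g y (J' z) = a2 * g y (I z) + b2 * g y (J z) + c2 * g y (K z)"
    "g y (K' z) = a3 * g y (I z) + b3 * g y (J z) + c3 * g y (K z)"
    by (simp_all only: I'[OF T(2)] J'[OF T(2)] K'[OF T(2)]) (simp_all add: T)
  ultimately show ?thesis by (simp only:) (simp add: algebra_simps)
qed

end

section \<open>Vector fields and directional derivatives\<close>

locale smooth_atlas =
  fixes M :: "('m, 'e::euclidean_space) manifold"
  assumes smooth_manifold: "smooth_manifold M"
begin

abbreviation "tangent \<equiv> tangent_space M"

lemma chart_openin: "c \<in> atlas M \<Longrightarrow> openin (mtop M) (fst c)"
  using smooth_manifold by (auto simp: smooth_manifold_def)

lemma chart_homeomorphic:
  assumes "c \<in> atlas M"
  shows "homeomorphic_map (subtopology (mtop M) (fst c)) (top_of_set (snd c ` fst c)) (snd c)"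
    and "open (snd c ` fst c)"
  using smooth_manifold assms by (auto simp: smooth_manifold_def)

lemma topspace_chart: "c \<in> atlas M \<Longrightarrow> topspace (subtopology (mtop M) (fst c)) = fst c"
  using openin_subset[OF chart_openin, of c] by auto

lemma chart_inv [simp]: "c \<in> atlas M \<Longrightarrow> q \<in> fst c \<Longrightarrow> chart_inv c (snd c q) = q"
  using homeomorphic_imp_injective_map[OF chart_homeomorphic(1), of c]
  by (simp add: chart_inv_def topspace_chart del: topspace_subtopology)

lemma open_chart_image:
  assumes "c \<in> atlas M" "openin (mtop M) U"
  shows "open (snd c ` (fst c \<inter> U))"
proof -
  have "openin (subtopology (mtop M) (fst c)) (fst c \<inter> U)"
    using assms(2) by (auto simp: openin_subtopology)
  then have "openin (top_of_set (snd c ` fst c)) (snd c ` (fst c \<inter> U))"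
    using homeomorphic_imp_open_map[OF chart_homeomorphic(1)[OF assms(1)]]
    by (simp add: open_map_def)
  then show ?thesis
    using chart_homeomorphic(2)[OF assms(1)] openin_open_trans by blast
qed

lemma transition_smooth:
  "c \<in> atlas M \<Longrightarrow> d \<in> atlas M \<Longrightarrow> smooth_on (snd c ` (fst c \<inter> fst d)) (snd d \<circ> chart_inv c)"
  using smooth_manifold by (simp add: smooth_manifold_def)

lemma charts_at_nonempty: "p \<in> topspace (mtop M) \<Longrightarrow> \<exists>c. c \<in> charts_at M p"
  using smooth_manifold unfolding smooth_manifold_def charts_at_def by blast

lemma openin_topspace: "openin (mtop M) U \<Longrightarrow> p \<in> U \<Longrightarrow> p \<in> topspace (mtop M)"
  using openin_subset[of "mtop M" U] by auto

lemma transition_differentiable: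
  assumes "c \<in> charts_at M p" "d \<in> charts_at M p"
  shows "(snd d \<circ> chart_inv c) differentiable (at (snd c p))"
  using assms by (intro smooth_on_differentiable[OF transition_smooth]) (auto simp: charts_at_def)

lemma tangentI:
  assumes "\<And>c d. c \<in> charts_at M p \<Longrightarrow> d \<in> charts_at M p \<Longrightarrow>
      v d = frechet_derivative (snd d \<circ> chart_inv c) (at (snd c p)) (v c)"
    and "\<And>c. c \<notin> charts_at M p \<Longrightarrow> v c = 0"
  shows "v \<in> tangent p"
  using assms unfolding tangent_space_def by blast

lemma tangentD:
  "v \<in> tangent p \<Longrightarrow> c \<in> charts_at M p \<Longrightarrow> d \<in> charts_at M p \<Longrightarrow>
    v d = frechet_derivative (snd d \<circ> chart_inv c) (at (snd c p)) (v c)"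
  unfolding tangent_space_def by blast

lemma tangentD0: "v \<in> tangent p \<Longrightarrow> c \<notin> charts_at M p \<Longrightarrow> v c = 0"
  unfolding tangent_space_def by blast

lemma subspace_tangent: "subspace (tangent p)"
proof -
  have lin: "linear (frechet_derivative (snd d \<circ> chart_inv c) (at (snd c p)))"
    if "c \<in> charts_at M p" "d \<in> charts_at M p" for c d
    using transition_differentiable[OF that] by (rule linear_frechet_derivative)
  show ?thesis
  proof (rule subspaceI)
    show "0 \<in> tangent p"
      by (rule tangentI) (simp_all add: linear_0[OF lin])
    show "x + y \<in> tangent p" if "x \<in> tangent p" "y \<in> tangent p" for x y
    proof (rule tangentI)
      fix c d assume cd: "c \<in> charts_at M p" "d \<in> charts_at M p"
      show "(x + y) d = frechet_derivative (snd d \<circ> chart_inv c) (at (snd c p)) ((x + y) c)"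
        by (simp only: plus_fun_apply linear_add[OF lin[OF cd]]
            tangentD[OF that(1) cd] tangentD[OF that(2) cd])
    qed (simp add: tangentD0[OF that(1)] tangentD0[OF that(2)])
    show "r *\<^sub>R x \<in> tangent p" if "x \<in> tangent p" for r x
    proof (rule tangentI)
      fix c d assume cd: "c \<in> charts_at M p" "d \<in> charts_at M p"
      show "(r *\<^sub>R x) d = frechet_derivative (snd d \<circ> chart_inv c) (at (snd c p)) ((r *\<^sub>R x) c)"
        by (simp only: scaleR_fun_def linear_scale[OF lin[OF cd]] tangentD[OF that cd])
    qed (simp add: scaleR_fun_def tangentD0[OF that])
  qed
qed

lemma vector_fieldD: "vector_field M U Y \<Longrightarrow> p \<in> U \<Longrightarrow> Y p \<in> tangent p"
  by (auto simp: vector_field_def)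

lemma vector_field_subset: "vector_field M U Y \<Longrightarrow> W \<subseteq> U \<Longrightarrow> vector_field M W Y"
  unfolding vector_field_def by (blast intro: smooth_on_subset)

lemma vector_field_cong:
  assumes "openin (mtop M) U" "\<And>p. p \<in> U \<Longrightarrow> Y p = Z p" "vector_field M U Y"
  shows "vector_field M U Z"
proof -
  have "smooth_on (snd c ` (fst c \<inter> U)) (\<lambda>u. Z (chart_inv c u) c)" if c: "c \<in> atlas M" for c
    by (rule smooth_on_cong[OF open_chart_image[OF c assms(1)], of "\<lambda>u. Y (chart_inv c u) c"])
      (use assms c in \<open>auto simp: vector_field_def\<close>)
  then show ?thesis using assms by (simp add: vector_field_def)
qed

lemma vector_field_add:
  assumes "openin (mtop M) U" "vector_field M U Y" "vector_field M U Z"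
  shows "vector_field M U (\<lambda>p. Y p + Z p)"
  using assms subspace_add[OF subspace_tangent]
  by (auto simp: vector_field_def intro!: smooth_on_add[OF open_chart_image])

lemma vector_field_scaleR:
  assumes "openin (mtop M) U" "smooth_function M U f" "vector_field M U Y"
  shows "vector_field M U (\<lambda>p. f p *\<^sub>R Y p)"
  using assms subspace_scale[OF subspace_tangent]
  by (auto simp: vector_field_def smooth_function_def scaleR_fun_def o_def
      intro!: smooth_on_scaleR[OF open_chart_image])

lemma smooth_function_const: "smooth_function M U (\<lambda>p. r)"
  by (simp add: smooth_function_def o_def smooth_on_const)

lemma smooth_function_subset: "smooth_function M U f \<Longrightarrow> W \<subseteq> U \<Longrightarrow> smooth_function M W f"
  unfolding smooth_function_def by (blast intro: smooth_on_subset)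

lemma vector_field_const_scaleR:
  "openin (mtop M) U \<Longrightarrow> vector_field M U Y \<Longrightarrow> vector_field M U (\<lambda>p. r *\<^sub>R Y p)"
  by (intro vector_field_scaleR smooth_function_const)

lemma vector_field_diff:
  assumes "openin (mtop M) U" "vector_field M U Y" "vector_field M U Z"
  shows "vector_field M U (\<lambda>p. Y p - Z p)"
  using vector_field_add[OF assms(1,2) vector_field_const_scaleR[OF assms(1,3), of "- 1"]] by simp

text \<open>The extension has constant coordinates in a chart around the point.\<close>

lemma vector_field_extension:
  assumes p: "p \<in> topspace (mtop M)" and v: "v \<in> tangent p"
  obtains U Y where "openin (mtop M) U" "p \<in> U" "vector_field M U Y" "Y p = v"
proof -
  obtain c where c: "c \<in> charts_at M p" using charts_at_nonempty[OF p] ..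
  then have cA: "c \<in> atlas M" and pc: "p \<in> fst c" by (auto simp: charts_at_def)
  define Y where "Y q = (\<lambda>d. if d \<in> charts_at M q
    then frechet_derivative (snd d \<circ> chart_inv c) (at (snd c q)) (v c) else 0)" for q
  have "Y p d = v d" for d
    using tangentD[OF v c, of d] tangentD0[OF v, of d] by (simp add: Y_def)
  then have "Y p = v" ..
  moreover have "vector_field M (fst c) Y"
    unfolding vector_field_def
  proof (intro conjI ballI)
    fix q assume q: "q \<in> fst c"
    then have cq: "c \<in> charts_at M q" using cA by (simp add: charts_at_def)
    \<comment> \<open>The cocycle rule for coordinate changes: the chain rule applied where all
      three charts overlap. It makes the components of \<open>Y q\<close> compatible.\<close>
    have chain: "frechet_derivative (snd e \<circ> chart_inv c) (at (snd c q)) (v c) =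
        frechet_derivative (snd e \<circ> chart_inv d) (at (snd d q))
          (frechet_derivative (snd d \<circ> chart_inv c) (at (snd c q)) (v c))"
      if d: "d \<in> charts_at M q" and e: "e \<in> charts_at M q" for d e
    proof -
      have de: "d \<in> atlas M" "e \<in> atlas M" "q \<in> fst d" "q \<in> fst e" using d e by (auto simp: charts_at_def)
      let ?S = "snd c ` (fst c \<inter> (fst d \<inter> fst e))"
      have "open ?S" using de by (intro open_chart_image[OF cA] openin_Int chart_openin)
      moreover have "snd c q \<in> ?S" using q de by auto
      moreover have "(snd e \<circ> chart_inv c) u = (snd e \<circ> chart_inv d \<circ> (snd d \<circ> chart_inv c)) u" if "u \<in> ?S" for u
        using that cA de by auto
      ultimately have "frechet_derivative (snd e \<circ> chart_inv c) (at (snd c q)) =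
          frechet_derivative (snd e \<circ> chart_inv d \<circ> (snd d \<circ> chart_inv c)) (at (snd c q))"
        by (rule frechet_derivative_cong_open)
      also have "\<dots> = frechet_derivative (snd e \<circ> chart_inv d) (at (snd d q)) \<circ>
          frechet_derivative (snd d \<circ> chart_inv c) (at (snd c q))"
        using transition_differentiable[OF cq d] transition_differentiable[OF d e] cA q
          frechet_derivative_compose[of "snd d \<circ> chart_inv c" "snd c q" "snd e \<circ> chart_inv d"]
        by simp
      finally show ?thesis by simp
    qed
    show "Y q \<in> tangent q"
    proof (rule tangentI)
      fix d e assume de: "d \<in> charts_at M q" "e \<in> charts_at M q"
      show "Y q e = frechet_derivative (snd e \<circ> chart_inv d) (at (snd d q)) (Y q d)"
        by (simp only: Y_def de if_True) (rule chain[OF de])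
    qed (simp add: Y_def)
  next
    fix d assume d: "d \<in> atlas M"
    let ?S = "snd d ` (fst d \<inter> fst c)" and ?S' = "snd c ` (fst c \<inter> fst d)"
    let ?h = "\<lambda>u. frechet_derivative (snd d \<circ> chart_inv c) (at u) (v c)"
    have S: "open ?S" using open_chart_image[OF d chart_openin[OF cA]] .
    have "smooth_on ?S (\<lambda>u. ?h ((snd c \<circ> chart_inv d) u))"
    proof (rule smooth_on_compose[OF S, where f = ?h and h = "snd c \<circ> chart_inv d" and S' = ?S'])
      show "(snd c \<circ> chart_inv d) ` ?S \<subseteq> ?S'" using d by auto
      show "smooth_on ?S' ?h"
        by (intro smooth_on_frechet_derivative transition_smooth cA d)
      show "smooth_on ?S (snd c \<circ> chart_inv d)"
        by (intro transition_smooth cA d)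
    qed
    then show "smooth_on ?S (\<lambda>u. Y (chart_inv d u) d)"
      by (rule smooth_on_cong[OF S, rotated]) (use d in \<open>auto simp: Y_def charts_at_def\<close>)
  qed
  ultimately show thesis using that chart_openin[OF cA] pc by blast
qed

lemma extend_tvec:
  assumes "p \<in> topspace (mtop M)" "y \<in> tangent p"
  obtains U where "openin (mtop M) U" "p \<in> U" "vector_field M U (extend_tvec M p y)"
    "extend_tvec M p y p = y"
proof -
  have "\<exists>Y. (\<exists>U. openin (mtop M) U \<and> p \<in> U \<and> vector_field M U Y) \<and> Y p = y"
    using vector_field_extension[OF assms] by metis
  from someI_ex[OF this] show thesis
    unfolding extend_tvec_def[symmetric] using that by blast
qed

section \<open>Calculus of directional derivatives\<close>

abbreviation "some_chart p \<equiv> (SOME c. c \<in> charts_at M p)"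

lemma some_chart: "p \<in> topspace (mtop M) \<Longrightarrow> some_chart p \<in> charts_at M p"
  using charts_at_nonempty by (rule someI_ex)

text \<open>Differentiability in the very chart that \<open>dir_deriv\<close> selects, so that the
  rules below involve no change of chart.\<close>

definition diff_at :: "'m \<Rightarrow> ('m \<Rightarrow> real) \<Rightarrow> bool"
  where "diff_at p f \<longleftrightarrow> (\<lambda>u. f (chart_inv (some_chart p) u)) differentiable (at (snd (some_chart p) p))"

lemma diff_atI:
  assumes "openin (mtop M) U" "p \<in> U" "smooth_function M U f"
  shows "diff_at p f"
proof -
  let ?c = "some_chart p"
  have c: "?c \<in> atlas M" "p \<in> fst ?c"
    using some_chart[OF openin_topspace[OF assms(1,2)]] by (auto simp: charts_at_def)
  have "smooth_on (snd ?c ` (fst ?c \<inter> U)) (\<lambda>u. f (chart_inv ?c u))"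
    using assms(3) c(1) by (simp add: smooth_function_def o_def)
  then show ?thesis
    unfolding diff_at_def by (rule smooth_on_differentiable) (use c assms(2) in auto)
qed

lemma dir_deriv_unfold:
  "dir_deriv M p v f =
    frechet_derivative (\<lambda>u. f (chart_inv (some_chart p) u)) (at (snd (some_chart p) p)) (v (some_chart p))"
  by (simp add: dir_deriv_def Let_def o_def)

lemma dir_deriv_cong:
  assumes "openin (mtop M) U" "p \<in> U" "\<And>q. q \<in> U \<Longrightarrow> f q = h q"
  shows "dir_deriv M p v f = dir_deriv M p v h"
proof -
  let ?c = "some_chart p"
  have c: "?c \<in> atlas M" "p \<in> fst ?c"
    using some_chart[OF openin_topspace[OF assms(1,2)]] by (auto simp: charts_at_def)
  have "frechet_derivative (\<lambda>u. f (chart_inv ?c u)) (at (snd ?c p)) =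
      frechet_derivative (\<lambda>u. h (chart_inv ?c u)) (at (snd ?c p))"
    by (rule frechet_derivative_cong_open[OF open_chart_image[OF c(1) assms(1)]])
      (use c assms(2,3) in auto)
  then show ?thesis by (simp add: dir_deriv_unfold)
qed

lemma dir_deriv_const: "dir_deriv M p v (\<lambda>q. r) = 0"
  by (simp add: dir_deriv_unfold)

lemma
  assumes "diff_at p f" "diff_at p h" "p \<in> topspace (mtop M)"
  shows diff_at_add: "diff_at p (\<lambda>q. f q + h q)"
    and dir_deriv_add: "dir_deriv M p v (\<lambda>q. f q + h q) = dir_deriv M p v f + dir_deriv M p v h"
    and diff_at_diff: "diff_at p (\<lambda>q. f q - h q)"
    and dir_deriv_diff: "dir_deriv M p v (\<lambda>q. f q - h q) = dir_deriv M p v f - dir_deriv M p v h"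
    and diff_at_mult: "diff_at p (\<lambda>q. f q * h q)"
    and dir_deriv_mult: "dir_deriv M p v (\<lambda>q. f q * h q) = f p * dir_deriv M p v h + dir_deriv M p v f * h p"
proof -
  let ?c = "some_chart p"
  let ?f = "\<lambda>u. f (chart_inv ?c u)" and ?h = "\<lambda>u. h (chart_inv ?c u)" and ?x = "snd ?c p"
  have c: "?c \<in> atlas M" "p \<in> fst ?c"
    using some_chart[OF assms(3)] by (auto simp: charts_at_def)
  have f: "(?f has_derivative frechet_derivative ?f (at ?x)) (at ?x)"
    and h: "(?h has_derivative frechet_derivative ?h (at ?x)) (at ?x)"
    using assms by (simp_all add: diff_at_def frechet_derivative_works)
  note add = has_derivative_add[OF f h] and diff = has_derivative_diff[OF f h]
    and mult = has_derivative_mult[OF f h]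
  show "diff_at p (\<lambda>q. f q + h q)" "diff_at p (\<lambda>q. f q - h q)" "diff_at p (\<lambda>q. f q * h q)"
    using add diff mult by (auto simp: diff_at_def differentiable_def)
  show "dir_deriv M p v (\<lambda>q. f q + h q) = dir_deriv M p v f + dir_deriv M p v h"
    "dir_deriv M p v (\<lambda>q. f q - h q) = dir_deriv M p v f - dir_deriv M p v h"
    "dir_deriv M p v (\<lambda>q. f q * h q) = f p * dir_deriv M p v h + dir_deriv M p v f * h p"
    using c frechet_derivative_at[OF add, symmetric] frechet_derivative_at[OF diff, symmetric]
      frechet_derivative_at[OF mult, symmetric]
    by (simp_all add: dir_deriv_unfold)
qed

end

section \<open>Covariant derivatives of skew endomorphism fields\<close>

locale metric_connection = smooth_atlas M
  for M :: "('m, 'e::euclidean_space) manifold" +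
  fixes g :: "('m, 'e) tensor2" and D :: "('m, 'e) connection"
  assumes metric: "pseudo_riemannian_metric M g"
    and connection: "affine_connection M D"
    and compatible: "metric_compatible M g D"
begin

lemma pseudo_euclidean_tangent:
  assumes "p \<in> topspace (mtop M)"
  shows "pseudo_euclidean (tangent p) (g p)"
proof -
  note m = metric[unfolded pseudo_riemannian_metric_def, THEN conjunct1, THEN bspec, OF assms]
  show ?thesis
  proof
    show "subspace (tangent p)" by (rule subspace_tangent)
    show "linear_on_subspace (tangent p) (g p x)" if "x \<in> tangent p" for x
      using m that by simp
    show "g p x y = g p y x" if "x \<in> tangent p" "y \<in> tangent p" for x y
      by (rule bspec[OF bspec[OF m[THEN conjunct2, THEN conjunct1] that(1)] that(2)])
    show "x = 0" if "x \<in> tangent p" "\<And>y. y \<in> tangent p \<Longrightarrow> g p x y = 0" for x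
      using m[THEN conjunct2, THEN conjunct2] that by simp
  qed
qed

lemma metric_smooth:
  "openin (mtop M) U \<Longrightarrow> vector_field M U Y \<Longrightarrow> vector_field M U Z \<Longrightarrow>
    smooth_function M U (\<lambda>q. g q (Y q) (Z q))"
  using metric[unfolded pseudo_riemannian_metric_def, THEN conjunct2] by simp

lemma
  assumes "openin (mtop M) U" "vector_field M U Y" "p \<in> U"
  shows D_in: "x \<in> tangent p \<Longrightarrow> D p x Y \<in> tangent p"
    and D_linear: "linear_on_subspace (tangent p) (\<lambda>x. D p x Y)"
    and D_add: "vector_field M U Z \<Longrightarrow> x \<in> tangent p \<Longrightarrow> D p x (\<lambda>q. Y q + Z q) = D p x Y + D p x Z"
    and D_cong: "vector_field M U Z \<Longrightarrow> x \<in> tangent p \<Longrightarrow> (\<And>q. q \<in> U \<Longrightarrow> Y q = Z q) \<Longrightarrow> D p x Y = D p x Z"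
    and D_scaleR: "smooth_function M U f \<Longrightarrow> x \<in> tangent p \<Longrightarrow>
      D p x (\<lambda>q. f q *\<^sub>R Y q) = dir_deriv M p x f *\<^sub>R Y p + f p *\<^sub>R D p x Y"
proof -
  note c = connection[unfolded affine_connection_def, THEN spec, THEN mp, OF assms(1),
      THEN spec, THEN mp, OF assms(2)]
  note c1 = c[THEN conjunct1, THEN bspec, OF assms(3)]
    and c2 = c[THEN conjunct2, THEN conjunct1, THEN spec, THEN mp, THEN bspec, OF _ assms(3), THEN bspec]
    and c3 = c[THEN conjunct2, THEN conjunct2, THEN conjunct1, THEN spec, THEN mp, THEN bspec,
      OF _ assms(3), THEN bspec]
  show "x \<in> tangent p \<Longrightarrow> D p x Y \<in> tangent p" "linear_on_subspace (tangent p) (\<lambda>x. D p x Y)"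
    using c1 by simp_all
  show "vector_field M U Z \<Longrightarrow> x \<in> tangent p \<Longrightarrow> D p x (\<lambda>q. Y q + Z q) = D p x Y + D p x Z"
    by (rule c2[THEN conjunct1])
  show "vector_field M U Z \<Longrightarrow> x \<in> tangent p \<Longrightarrow> (\<And>q. q \<in> U \<Longrightarrow> Y q = Z q) \<Longrightarrow> D p x Y = D p x Z"
    by (rule c2[THEN conjunct2, THEN mp]) auto
  show "smooth_function M U f \<Longrightarrow> x \<in> tangent p \<Longrightarrow>
      D p x (\<lambda>q. f q *\<^sub>R Y q) = dir_deriv M p x f *\<^sub>R Y p + f p *\<^sub>R D p x Y"
    by (rule c3)
qed

lemma D_field:
  "openin (mtop M) U \<Longrightarrow> vector_field M U Y \<Longrightarrow> vector_field M U X \<Longrightarrow> vector_field M U (\<lambda>p. D p (X p) Y)"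
  using connection[unfolded affine_connection_def, THEN spec, THEN mp, THEN spec, THEN mp]
  by simp

lemma D_const_scaleR:
  assumes "openin (mtop M) U" "vector_field M U Y" "p \<in> U" "x \<in> tangent p"
  shows "D p x (\<lambda>q. r *\<^sub>R Y q) = r *\<^sub>R D p x Y"
  using D_scaleR[OF assms(1-3) smooth_function_const assms(4), of r] by (simp add: dir_deriv_const)

lemma dir_deriv_metric:
  "openin (mtop M) U \<Longrightarrow> vector_field M U Y \<Longrightarrow> vector_field M U Z \<Longrightarrow> p \<in> U \<Longrightarrow> x \<in> tangent p \<Longrightarrow>
    dir_deriv M p x (\<lambda>q. g q (Y q) (Z q)) = g p (D p x Y) (Z p) + g p (Y p) (D p x Z)"
  using compatible[unfolded metric_compatible_def] by simp

definition skew_field :: "'m set \<Rightarrow> ('m \<Rightarrow> ('m, 'e) tend) \<Rightarrow> bool"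
  where "skew_field U A \<longleftrightarrow> openin (mtop M) U \<and> endo_field M U A \<and> (\<forall>q\<in>U. skew_at M g q (A q))"

lemma skew_fieldD:
  assumes "skew_field U A"
  shows "openin (mtop M) U"
    and "p \<in> U \<Longrightarrow> x \<in> tangent p \<Longrightarrow> A p x \<in> tangent p"
    and "p \<in> U \<Longrightarrow> x \<in> tangent p \<Longrightarrow> y \<in> tangent p \<Longrightarrow> g p (A p x) y = - g p x (A p y)"
    and "p \<in> U \<Longrightarrow> linear_on_subspace (tangent p) (A p)"
    and "openin (mtop M) W \<Longrightarrow> W \<subseteq> U \<Longrightarrow> vector_field M W Y \<Longrightarrow> vector_field M W (\<lambda>p. A p (Y p))"
  using assms by (auto simp: skew_field_def endo_field_def endo_space_def skew_at_def)

lemma skew_field_subset: "skew_field U A \<Longrightarrow> openin (mtop M) W \<Longrightarrow> W \<subseteq> U \<Longrightarrow> skew_field W A"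
  unfolding skew_field_def endo_field_def by (meson subset_iff subset_trans)

text \<open>In contrast to \<open>cov_deriv_endo\<close>, this takes a field and chooses no
  extension; that only the value of the field at the point matters is proved afterwards.\<close>

definition nabla :: "('m \<Rightarrow> ('m, 'e) tend) \<Rightarrow> 'm \<Rightarrow> ('m, 'e) tvec \<Rightarrow> ('m \<Rightarrow> ('m, 'e) tvec) \<Rightarrow> ('m, 'e) tvec"
  where "nabla A p x Y = D p x (\<lambda>q. A q (Y q)) - A p (D p x Y)"

lemma nabla_in:
  assumes "skew_field U A" "vector_field M U Y" "p \<in> U" "x \<in> tangent p"
  shows "nabla A p x Y \<in> tangent p"
  unfolding nabla_def
  using assms skew_fieldD(1,2,5)[OF assms(1)] D_in
  by (intro subspace_diff[OF subspace_tangent]) auto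

text \<open>Metric compatibility turns the derivative of \<open>g (A Y) Z + g Y (A Z) = 0\<close>
  into this identity, the terms in \<open>D p x Y\<close> and \<open>D p x Z\<close> being absorbed
  by the skewness of \<open>A p\<close>.\<close>

lemma nabla_skew:
  assumes A: "skew_field U A" and YZ: "vector_field M U Y" "vector_field M U Z"
    and p: "p \<in> U" and x: "x \<in> tangent p"
  shows "g p (nabla A p x Y) (Z p) = - g p (Y p) (nabla A p x Z)"
proof -
  note U = skew_fieldD(1)[OF A]
  note pT = openin_topspace[OF U p]
  interpret pseudo_euclidean "tangent p" "g p" by (rule pseudo_euclidean_tangent[OF pT])
  have AYZ: "vector_field M U (\<lambda>q. A q (Y q))" "vector_field M U (\<lambda>q. A q (Z q))"
    using skew_fieldD(5)[OF A U] YZ by auto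
  have in_tangent: "Y p \<in> tangent p" "Z p \<in> tangent p" "D p x Y \<in> tangent p" "D p x Z \<in> tangent p"
    "D p x (\<lambda>q. A q (Y q)) \<in> tangent p" "D p x (\<lambda>q. A q (Z q)) \<in> tangent p"
    "A p (D p x Y) \<in> tangent p" "A p (D p x Z) \<in> tangent p"
    using vector_fieldD YZ AYZ p x D_in[OF U] skew_fieldD(2)[OF A p] by auto
  have "0 = dir_deriv M p x (\<lambda>q. g q (A q (Y q)) (Z q) + g q (Y q) (A q (Z q)))"
  proof -
    have "dir_deriv M p x (\<lambda>q. g q (A q (Y q)) (Z q) + g q (Y q) (A q (Z q))) = dir_deriv M p x (\<lambda>q. 0)"
      using skew_fieldD(3)[OF A] vector_fieldD[OF YZ(1)] vector_fieldD[OF YZ(2)]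
      by (intro dir_deriv_cong[OF U p]) auto
    then show ?thesis by (simp add: dir_deriv_const)
  qed
  also have "\<dots> = dir_deriv M p x (\<lambda>q. g q (A q (Y q)) (Z q)) + dir_deriv M p x (\<lambda>q. g q (Y q) (A q (Z q)))"
    by (intro dir_deriv_add diff_atI[OF U p] metric_smooth U YZ AYZ pT)
  also have "\<dots> = g p (D p x (\<lambda>q. A q (Y q))) (Z p) + g p (A p (Y p)) (D p x Z) +
      (g p (D p x Y) (A p (Z p)) + g p (Y p) (D p x (\<lambda>q. A q (Z q))))"
    using dir_deriv_metric[OF U AYZ(1) YZ(2) p x] dir_deriv_metric[OF U YZ(1) AYZ(2) p x] by simp
  finally show ?thesis
    using skew_fieldD(3)[OF A p] in_tangent by (simp add: nabla_def)
qed

text \<open>Skewness makes \<open>nabla\<close> tensorial without recourse to local frames.\<close>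

lemma nabla_cong:
  assumes A: "skew_field U A" "p \<in> U" and x: "x \<in> tangent p"
    and Y: "openin (mtop M) W" "vector_field M W Y" "p \<in> W"
    and Y': "openin (mtop M) W'" "vector_field M W' Y'" "p \<in> W'"
    and eq: "Y p = Y' p"
  shows "nabla A p x Y = nabla A p x Y'"
proof -
  note U = skew_fieldD(1)[OF A(1)]
  note pT = openin_topspace[OF U A(2)]
  interpret pseudo_euclidean "tangent p" "g p" by (rule pseudo_euclidean_tangent[OF pT])
  let ?W = "U \<inter> W \<inter> W'"
  have W: "openin (mtop M) ?W" "p \<in> ?W" using U A Y Y' by auto
  have nab: "nabla A p x Y \<in> tangent p" "nabla A p x Y' \<in> tangent p"
    using nabla_in[of ?W A _ p x] W A Y Y' x skew_field_subset[OF A(1) W(1)] vector_field_subset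
    by (metis inf_le1 inf_le2 le_infI1 order_trans)+
  show ?thesis
  proof (rule eqI[OF nab])
    fix w assume w: "w \<in> tangent p"
    obtain V Z where Z: "openin (mtop M) V" "p \<in> V" "vector_field M V Z" "Z p = w"
      using vector_field_extension[OF pT w] .
    let ?V = "?W \<inter> V"
    have V: "openin (mtop M) ?V" "p \<in> ?V" using W Z by auto
    have fields: "vector_field M ?V Y" "vector_field M ?V Y'" "vector_field M ?V Z"
      using Y Y' Z by (auto elim: vector_field_subset)
    have AV: "skew_field ?V A" using skew_field_subset[OF A(1) V(1)] by auto
    \<comment> \<open>By skewness the left side equals \<open>- g p (nabla A p x Z) (Y p)\<close>,
      which depends on \<open>Y\<close> only through \<open>Y p\<close>.\<close>
    show "g p w (nabla A p x Y) = g p w (nabla A p x Y')"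
      using nabla_skew[OF AV fields(3,1) V(2) x] nabla_skew[OF AV fields(3,2) V(2) x] Z(4) eq by simp
  qed
qed

abbreviation "nabla_endo \<equiv> cov_deriv_endo M D"

text \<open>Frees the covariant derivative from the extension chosen in its definition, so that one
  field on a convenient domain can serve a whole calculation.\<close>

lemma nabla_endo_eq:
  assumes A: "skew_field U A" "p \<in> U" and x: "x \<in> tangent p"
    and Y: "openin (mtop M) W" "vector_field M W Y" "p \<in> W"
  shows "nabla_endo A p x (Y p) = nabla A p x Y"
proof -
  have y: "Y p \<in> tangent p" using vector_fieldD[OF Y(2,3)] .
  obtain V where V: "openin (mtop M) V" "p \<in> V" "vector_field M V (extend_tvec M p (Y p))"
    "extend_tvec M p (Y p) p = Y p"
    using extend_tvec[OF openin_topspace[OF Y(1,3)] y] .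
  show ?thesis
    using nabla_cong[OF A x V(1,3,2) Y V(4)] y by (simp add: cov_deriv_endo_def nabla_def Let_def)
qed

lemma common_extension:
  assumes "openin (mtop M) U" "p \<in> U" "y \<in> tangent p" "z \<in> tangent p"
  obtains W Y Z where "openin (mtop M) W" "p \<in> W" "W \<subseteq> U" "vector_field M W Y" "vector_field M W Z"
    "Y p = y" "Z p = z"
proof -
  note pT = openin_topspace[OF assms(1,2)]
  obtain V Y where Y: "openin (mtop M) V" "p \<in> V" "vector_field M V Y" "Y p = y"
    using vector_field_extension[OF pT assms(3)] .
  obtain V' Z where Z: "openin (mtop M) V'" "p \<in> V'" "vector_field M V' Z" "Z p = z"
    using vector_field_extension[OF pT assms(4)] .
  show thesis
    by (rule that[of "U \<inter> (V \<inter> V')" Y Z])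
      (use assms Y Z in \<open>auto elim: vector_field_subset\<close>)
qed

lemma
  assumes A: "skew_field U A" "p \<in> U" and x: "x \<in> tangent p"
  shows nabla_endo_in: "y \<in> tangent p \<Longrightarrow> nabla_endo A p x y \<in> tangent p"
    and nabla_endo_skew: "y \<in> tangent p \<Longrightarrow> z \<in> tangent p \<Longrightarrow>
      g p (nabla_endo A p x y) z = - g p y (nabla_endo A p x z)"
proof -
  have *: "nabla_endo A p x y \<in> tangent p \<and> g p (nabla_endo A p x y) z = - g p y (nabla_endo A p x z)"
    if yz: "y \<in> tangent p" "z \<in> tangent p" for y z
  proof -
    obtain W Y Z where W: "openin (mtop M) W" "p \<in> W" "W \<subseteq> U" "vector_field M W Y" "vector_field M W Z"
      "Y p = y" "Z p = z"
      using common_extension[OF skew_fieldD(1)[OF A(1)] A(2) yz] .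
    have AW: "skew_field W A" using skew_field_subset[OF A(1) W(1,3)] .
    show ?thesis
      using nabla_endo_eq[OF A x W(1,4,2)] nabla_endo_eq[OF A x W(1,5,2)]
        nabla_in[OF AW W(4,2) x] nabla_skew[OF AW W(4,5,2) x] W(6,7) by simp
  qed
  then show "y \<in> tangent p \<Longrightarrow> nabla_endo A p x y \<in> tangent p"
    and "y \<in> tangent p \<Longrightarrow> z \<in> tangent p \<Longrightarrow>
      g p (nabla_endo A p x y) z = - g p y (nabla_endo A p x z)"
    by blast+
qed

text \<open>Additivity in the direction is what carries the result from non-null to null
  vectors.\<close>

lemma nabla_endo_add:
  assumes A: "skew_field U A" "p \<in> U" and x: "x \<in> tangent p" "x' \<in> tangent p" and y: "y \<in> tangent p"
  shows "nabla_endo A p (x + x') y = nabla_endo A p x y + nabla_endo A p x' y"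
proof -
  note U = skew_fieldD(1)[OF A(1)]
  obtain W Y where W: "openin (mtop M) W" "p \<in> W" "W \<subseteq> U" "vector_field M W Y" "Y p = y"
    using common_extension[OF U A(2) y y] by blast
  have AY: "vector_field M W (\<lambda>q. A q (Y q))" using skew_fieldD(5)[OF A(1) W(1,3,4)] .
  have add: "D p (x + x') Y = D p x Y + D p x' Y"
    "D p (x + x') (\<lambda>q. A q (Y q)) = D p x (\<lambda>q. A q (Y q)) + D p x' (\<lambda>q. A q (Y q))"
    using D_linear[OF W(1,4,2)] D_linear[OF W(1) AY W(2)] x by (auto simp: linear_on_subspace_def)
  have "A p (D p x Y + D p x' Y) = A p (D p x Y) + A p (D p x' Y)"
    using skew_fieldD(4)[OF A] D_in[OF W(1,4,2)] x by (simp add: linear_on_subspace_def)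
  then show ?thesis
    using nabla_endo_eq[OF A x(1) W(1,4,2)] nabla_endo_eq[OF A x(2) W(1,4,2)]
      nabla_endo_eq[OF A subspace_add[OF subspace_tangent x] W(1,4,2)] W(5)
    by (simp add: nabla_def add)
qed

lemma D_product:
  assumes A: "skew_field U A" and B: "skew_field U B" and p: "p \<in> U" and x: "x \<in> tangent p"
    and W: "openin (mtop M) W" "p \<in> W" "W \<subseteq> U" "vector_field M W Y"
  shows "D p x (\<lambda>q. A q (B q (Y q))) =
    A p (B p (D p x Y)) + nabla_endo A p x (B p (Y p)) + A p (nabla_endo B p x (Y p))"
proof -
  have BY: "vector_field M W (\<lambda>q. B q (Y q))" using skew_fieldD(5)[OF B W(1,3,4)] .
  have "A p (D p x (\<lambda>q. B q (Y q)) - B p (D p x Y)) = A p (D p x (\<lambda>q. B q (Y q))) - A p (B p (D p x Y))"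
    by (intro linear_on_subspace_diff[OF skew_fieldD(4)[OF A p] subspace_tangent]
        D_in[OF W(1) BY W(2) x] skew_fieldD(2)[OF B p] D_in[OF W(1,4,2) x])
  then show ?thesis
    using nabla_endo_eq[OF A p x W(1) BY W(2)] nabla_endo_eq[OF B p x W(1,4,2)]
    by (simp add: nabla_def)
qed

text \<open>The factor \<open>r\<close> covers both \<open>K = I J\<close> and
  \<open>K = - J I\<close>.\<close>

lemma nabla_endo_mult:
  assumes A: "skew_field U A" and B: "skew_field U B" and C: "skew_field U C"
    and CAB: "\<And>q y. q \<in> U \<Longrightarrow> y \<in> tangent q \<Longrightarrow> C q y = r *\<^sub>R A q (B q y)"
    and p: "p \<in> U" and x: "x \<in> tangent p" and y: "y \<in> tangent p"
  shows "nabla_endo C p x y = r *\<^sub>R (nabla_endo A p x (B p y) + A p (nabla_endo B p x y))"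
proof -
  note U = skew_fieldD(1)[OF A]
  obtain W Y where W: "openin (mtop M) W" "p \<in> W" "W \<subseteq> U" "vector_field M W Y" "Y p = y"
    using common_extension[OF U p y y] by blast
  have ABY: "vector_field M W (\<lambda>q. A q (B q (Y q)))"
    using skew_fieldD(5)[OF A W(1,3) skew_fieldD(5)[OF B W(1,3,4)]] .
  have CY: "vector_field M W (\<lambda>q. C q (Y q))" using skew_fieldD(5)[OF C W(1,3,4)] .
  have "D p x (\<lambda>q. C q (Y q)) = D p x (\<lambda>q. r *\<^sub>R A q (B q (Y q)))"
    using CAB vector_fieldD[OF W(4)] W(3)
    by (intro D_cong[OF W(1) CY W(2) vector_field_const_scaleR[OF W(1) ABY] x]) auto
  also have "\<dots> = r *\<^sub>R D p x (\<lambda>q. A q (B q (Y q)))"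
    by (rule D_const_scaleR[OF W(1) ABY W(2) x])
  finally show ?thesis
    using D_product[OF A B p x W(1-4)] nabla_endo_eq[OF C p x W(1,4,2)] W(5)
      CAB[OF p D_in[OF W(1,4,2) x]]
    by (simp add: nabla_def algebra_simps)
qed

text \<open>Not an instance of \<open>nabla_endo_mult\<close>: a multiple of the identity is
  symmetric rather than skew, so it cannot play the role of \<open>C\<close> there.\<close>

lemma nabla_endo_square:
  assumes A: "skew_field U A"
    and AA: "\<And>q y. q \<in> U \<Longrightarrow> y \<in> tangent q \<Longrightarrow> A q (A q y) = r *\<^sub>R y"
    and p: "p \<in> U" and x: "x \<in> tangent p" and y: "y \<in> tangent p"
  shows "nabla_endo A p x (A p y) + A p (nabla_endo A p x y) = 0"
proof -
  note U = skew_fieldD(1)[OF A]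
  obtain W Y where W: "openin (mtop M) W" "p \<in> W" "W \<subseteq> U" "vector_field M W Y" "Y p = y"
    using common_extension[OF U p y y] by blast
  have AAY: "vector_field M W (\<lambda>q. A q (A q (Y q)))"
    using skew_fieldD(5)[OF A W(1,3) skew_fieldD(5)[OF A W(1,3,4)]] .
  have "D p x (\<lambda>q. A q (A q (Y q))) = D p x (\<lambda>q. r *\<^sub>R Y q)"
    using AA vector_fieldD[OF W(4)] W(3)
    by (intro D_cong[OF W(1) AAY W(2) vector_field_const_scaleR[OF W(1,4)] x]) auto
  also have "\<dots> = r *\<^sub>R D p x Y"
    by (rule D_const_scaleR[OF W(1,4,2) x])
  finally show ?thesis
    using D_product[OF A A p x W(1-4)] W(5) AA[OF p D_in[OF W(1,4,2) x]] by simp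
qed

end

section \<open>The fundamental 4-form\<close>

lemma in_span3:
  "A \<in> span {I, J, K} \<longleftrightarrow> (\<exists>a b c. A = a *\<^sub>R I + b *\<^sub>R J + c *\<^sub>R K)"
  for A I J K :: "'a::real_vector"
proof
  assume "A \<in> span {I, J, K}"
  then obtain a b c where "A - a *\<^sub>R I - b *\<^sub>R J - c *\<^sub>R K = 0"
    by (auto simp: span_breakdown_eq)
  then have "A = a *\<^sub>R I + b *\<^sub>R J + c *\<^sub>R K" by (simp add: algebra_simps)
  then show "\<exists>a b c. A = a *\<^sub>R I + b *\<^sub>R J + c *\<^sub>R K" by blast
next
  have "I \<in> span {I, J, K}" "J \<in> span {I, J, K}" "K \<in> span {I, J, K}"
    by (simp_all add: span_base)
  then show "\<exists>a b c. A = a *\<^sub>R I + b *\<^sub>R J + c *\<^sub>R K \<Longrightarrow> A \<in> span {I, J, K}"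
    by (auto intro!: span_add span_scale)
qed

locale almost_pq_connection = metric_connection M g D
  for M :: "('m, 'e::euclidean_space) manifold" and g :: "('m, 'e) tensor2" and D :: "('m, 'e) connection" +
  fixes V :: "'m \<Rightarrow> ('m, 'e) tend set"
  assumes hermitian: "almost_para_quaternion_hermitian M g V"
begin

lemma pq_basis_hermitian:
  assumes "pq_basis_at M g V p I J K" "p \<in> topspace (mtop M)"
  shows "para_quaternionic_hermitian (tangent p) (g p) I J K"
proof -
  interpret pseudo_euclidean "tangent p" "g p" by (rule pseudo_euclidean_tangent[OF assms(2)])
  show ?thesis
    using assms(1)
    by unfold_locales (simp_all add: pq_basis_at_def endo_space_def skew_at_def)
qed

text \<open>On a zero tangent space all elements of \<open>endo_space\<close> coincide, as they also
  vanish off the space, but a basis has three distinct members.\<close>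

lemma pq_basis_nontrivial:
  assumes "pq_basis_at M g V p I J K" "p \<in> topspace (mtop M)"
  obtains x where "x \<in> tangent p" "x \<noteq> 0"
proof (rule ccontr)
  assume *: "\<not> thesis"
  have z: "x = 0" if "x \<in> tangent p" for x using * \<open>\<And>x. x \<in> tangent p \<Longrightarrow> x \<noteq> 0 \<Longrightarrow> thesis\<close> that by blast
  have lin: "linear_on_subspace (tangent p) I" "linear_on_subspace (tangent p) J"
    and off: "\<And>x. x \<notin> tangent p \<Longrightarrow> I x = 0 \<and> J x = 0"
    using assms(1) by (auto simp: pq_basis_at_def endo_space_def)
  have "I x = J x" for x
    using off[of x] z[of x] lin[THEN linear_on_subspace_zero[OF _ subspace_tangent]] by (cases "x \<in> tangent p") auto
  then have "I = J" ..
  then have "card {I, J, K} \<le> 2" using card_insert_le_m1[of 2 "{K}" J] by simp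
  then show False using assms(1) by (simp add: pq_basis_at_def)
qed

lemma pq_basis_span:
  assumes "pq_basis_at M g V p I J K" "A \<in> V p"
  obtains a b c where "A = a *\<^sub>R I + b *\<^sub>R J + c *\<^sub>R K" "\<And>z. A z = a *\<^sub>R I z + b *\<^sub>R J z + c *\<^sub>R K z"
proof -
  have "A \<in> span {I, J, K}" using assms by (simp add: pq_basis_at_def)
  then show thesis
    unfolding in_span3 using that by (auto simp: scaleR_fun_def)
qed

text \<open>Exchanges the pointwise selected basis for any adapted one, in particular for the values
  of a smooth local basis; only then can the form be differentiated.\<close>

lemma fundamental_form_eq:
  assumes B: "pq_basis_at M g V p I J K" and p: "p \<in> topspace (mtop M)"
    and args: "y \<in> tangent p" "z \<in> tangent p" "w \<in> tangent p" "u \<in> tangent p"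
  shows "fundamental_form M g V p y z w u = wedge_square (two_form g p I) y z w u
    - wedge_square (two_form g p J) y z w u - wedge_square (two_form g p K) y z w u"
proof -
  obtain I' J' K' where sel: "(SOME (I, J, K). pq_basis_at M g V p I J K) = (I', J', K')"
    using prod_cases3 by blast
  have "case (SOME (I, J, K). pq_basis_at M g V p I J K) of (I, J, K) \<Rightarrow> pq_basis_at M g V p I J K"
    by (rule someI[where x = "(I, J, K)"]) (simp add: B)
  then have B': "pq_basis_at M g V p I' J' K'" by (simp add: sel)
  interpret para_quaternionic_hermitian "tangent p" "g p" I J K by (rule pq_basis_hermitian[OF B p])
  obtain x where x: "x \<in> tangent p" "x \<noteq> 0" using pq_basis_nontrivial[OF B p] .
  have inV: "I \<in> V p" "J \<in> V p" "K \<in> V p" "I' \<in> V p" "J' \<in> V p" "K' \<in> V p"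
    using B B' by (auto simp: pq_basis_at_def intro: span_base)
  obtain a1 b1 c1 where 1: "\<And>z. I' z = a1 *\<^sub>R I z + b1 *\<^sub>R J z + c1 *\<^sub>R K z" using pq_basis_span[OF B inV(4)] by metis
  obtain a2 b2 c2 where 2: "\<And>z. J' z = a2 *\<^sub>R I z + b2 *\<^sub>R J z + c2 *\<^sub>R K z" using pq_basis_span[OF B inV(5)] by metis
  obtain a3 b3 c3 where 3: "\<And>z. K' z = a3 *\<^sub>R I z + b3 *\<^sub>R J z + c3 *\<^sub>R K z" using pq_basis_span[OF B inV(6)] by metis
  obtain p1 q1 r1 where 4: "\<And>z. I z = p1 *\<^sub>R I' z + q1 *\<^sub>R J' z + r1 *\<^sub>R K' z" using pq_basis_span[OF B' inV(1)] by metis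
  obtain p2 q2 r2 where 5: "\<And>z. J z = p2 *\<^sub>R I' z + q2 *\<^sub>R J' z + r2 *\<^sub>R K' z" using pq_basis_span[OF B' inV(2)] by metis
  obtain p3 q3 r3 where 6: "\<And>z. K z = p3 *\<^sub>R I' z + q3 *\<^sub>R J' z + r3 *\<^sub>R K' z" using pq_basis_span[OF B' inV(3)] by metis
  note sum = adapted_basis_sum[OF pq_basis_hermitian[OF B' p] x 1 2 3 4 5 6]
  show ?thesis
    \<comment> \<open>One instance for each of the three cyclic pairings in
      \<open>wedge_square\<close>.\<close>
    using sum[OF args] sum[OF args(1,3,4,2)] sum[OF args(1,4,2,3)]
    by (simp add: fundamental_form_def sel wedge_square_def two_form_def)
qed

lemma local_basis:
  assumes "p \<in> topspace (mtop M)"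
  obtains U I J K where "p \<in> U" "skew_field U I" "skew_field U J" "skew_field U K"
    "\<And>q. q \<in> U \<Longrightarrow> pq_basis_at M g V q (I q) (J q) (K q)"
proof -
  have "\<exists>U I J K. openin (mtop M) U \<and> p \<in> U \<and>
       endo_field M U I \<and> endo_field M U J \<and> endo_field M U K \<and>
       (\<forall>q\<in>U. pq_basis_at M g V q (I q) (J q) (K q))"
    using hermitian assms by (simp add: almost_para_quaternion_hermitian_def)
  then obtain U I J K where "openin (mtop M) U" "p \<in> U"
    "endo_field M U I" "endo_field M U J" "endo_field M U K"
    "\<And>q. q \<in> U \<Longrightarrow> pq_basis_at M g V q (I q) (J q) (K q)"
    by metis
  then show thesis
    by (intro that[of U I J K]) (auto simp: skew_field_def pq_basis_at_def)
qed

section \<open>Differentiating the fundamental form\<close>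

lemma
  assumes "diff_at p f1" "diff_at p f2" "diff_at p f3" "diff_at p f4" "diff_at p f5" "diff_at p f6"
    and p: "p \<in> topspace (mtop M)"
  shows diff_at_wedge: "diff_at p (\<lambda>q. 2 * (f1 q * f2 q + f3 q * f4 q + f5 q * f6 q))"
    and dir_deriv_wedge: "dir_deriv M p v (\<lambda>q. 2 * (f1 q * f2 q + f3 q * f4 q + f5 q * f6 q)) =
      2 * (f1 p * dir_deriv M p v f2 + dir_deriv M p v f1 * f2 p +
           f3 p * dir_deriv M p v f4 + dir_deriv M p v f3 * f4 p +
           f5 p * dir_deriv M p v f6 + dir_deriv M p v f5 * f6 p)"
proof -
  have c: "diff_at p (\<lambda>q. 2)" by (simp add: diff_at_def)
  note d = diff_at_mult[OF assms(1,2) p] diff_at_mult[OF assms(3,4) p] diff_at_mult[OF assms(5,6) p]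
  note d2 = diff_at_add[OF d(1,2) p] and d3 = diff_at_add[OF diff_at_add[OF d(1,2) p] d(3) p]
  show "diff_at p (\<lambda>q. 2 * (f1 q * f2 q + f3 q * f4 q + f5 q * f6 q))"
    by (rule diff_at_mult[OF c d3 p])
  show "dir_deriv M p v (\<lambda>q. 2 * (f1 q * f2 q + f3 q * f4 q + f5 q * f6 q)) =
      2 * (f1 p * dir_deriv M p v f2 + dir_deriv M p v f1 * f2 p +
           f3 p * dir_deriv M p v f4 + dir_deriv M p v f3 * f4 p +
           f5 p * dir_deriv M p v f6 + dir_deriv M p v f5 * f6 p)"
    by (simp only: dir_deriv_mult[OF c d3 p] dir_deriv_add[OF d2 d(3) p] dir_deriv_add[OF d(1,2) p]
        dir_deriv_mult[OF assms(1,2) p] dir_deriv_mult[OF assms(3,4) p] dir_deriv_mult[OF assms(5,6) p]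
        dir_deriv_const) simp
qed

lemma dir_deriv_two_form:
  assumes A: "skew_field U A" and YZ: "vector_field M U Y" "vector_field M U Z" and p: "p \<in> U"
    and x: "x \<in> tangent p"
  shows "dir_deriv M p x (\<lambda>q. g q (Y q) (A q (Z q))) = g p (D p x Y) (A p (Z p)) +
      g p (Y p) (A p (D p x Z)) + g p (Y p) (nabla_endo A p x (Z p))"
    and "diff_at p (\<lambda>q. g q (Y q) (A q (Z q)))"
proof -
  note U = skew_fieldD(1)[OF A]
  interpret pseudo_euclidean "tangent p" "g p"
    by (rule pseudo_euclidean_tangent[OF openin_topspace[OF U p]])
  have AZ: "vector_field M U (\<lambda>q. A q (Z q))" using skew_fieldD(5)[OF A U] YZ by auto
  have "D p x (\<lambda>q. A q (Z q)) = A p (D p x Z) + nabla_endo A p x (Z p)"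
    using nabla_endo_eq[OF A p x U YZ(2) p] by (simp add: nabla_def)
  moreover have "g p (Y p) (A p (D p x Z) + nabla_endo A p x (Z p)) =
      g p (Y p) (A p (D p x Z)) + g p (Y p) (nabla_endo A p x (Z p))"
    using vector_fieldD[OF YZ(1) p] vector_fieldD[OF YZ(2) p] skew_fieldD(2)[OF A p]
      D_in[OF U YZ(2) p x] nabla_endo_in[OF A p x] by simp
  ultimately show "dir_deriv M p x (\<lambda>q. g q (Y q) (A q (Z q))) = g p (D p x Y) (A p (Z p)) +
      g p (Y p) (A p (D p x Z)) + g p (Y p) (nabla_endo A p x (Z p))"
    using dir_deriv_metric[OF U YZ(1) AZ p x] by simp
  show "diff_at p (\<lambda>q. g q (Y q) (A q (Z q)))"
    by (rule diff_atI[OF U p metric_smooth[OF U YZ(1) AZ]])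
qed

text \<open>The first four summands are the correction terms subtracted in
  \<open>cov_deriv_form4\<close>; the remaining six are the contribution of \<open>A\<close> to
  \<open>dform\<close>.\<close>

lemma dir_deriv_wedge_square:
  fixes A
  defines "\<Psi> \<equiv> \<lambda>q. wedge_square (two_form g q (A q))"
  assumes A: "skew_field U A" and F: "vector_field M U Y" "vector_field M U Z" "vector_field M U W"
    "vector_field M U X" and p: "p \<in> U" and x: "x \<in> tangent p"
  shows "dir_deriv M p x (\<lambda>q. \<Psi> q (Y q) (Z q) (W q) (X q)) =
      \<Psi> p (D p x Y) (Z p) (W p) (X p) + \<Psi> p (Y p) (D p x Z) (W p) (X p) +
      \<Psi> p (Y p) (Z p) (D p x W) (X p) + \<Psi> p (Y p) (Z p) (W p) (D p x X) +
      2 * (g p (Y p) (nabla_endo A p x (Z p)) * g p (W p) (A p (X p))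
         + g p (Y p) (A p (Z p)) * g p (W p) (nabla_endo A p x (X p))
         + g p (Y p) (nabla_endo A p x (W p)) * g p (X p) (A p (Z p))
         + g p (Y p) (A p (W p)) * g p (X p) (nabla_endo A p x (Z p))
         + g p (Y p) (nabla_endo A p x (X p)) * g p (Z p) (A p (W p))
         + g p (Y p) (A p (X p)) * g p (Z p) (nabla_endo A p x (W p)))" (is ?eq)
    and "diff_at p (\<lambda>q. \<Psi> q (Y q) (Z q) (W q) (X q))"
proof -
  note pT = openin_topspace[OF skew_fieldD(1)[OF A] p]
  note d = dir_deriv_two_form(2)[OF A F(1) F(2) p x] dir_deriv_two_form(2)[OF A F(3) F(4) p x]
    dir_deriv_two_form(2)[OF A F(1) F(3) p x] dir_deriv_two_form(2)[OF A F(4) F(2) p x]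
    dir_deriv_two_form(2)[OF A F(1) F(4) p x] dir_deriv_two_form(2)[OF A F(2) F(3) p x]
  show ?eq
    unfolding \<Psi>_def wedge_square_def two_form_def dir_deriv_wedge[OF d pT]
      dir_deriv_two_form(1)[OF A F(1) F(2) p x] dir_deriv_two_form(1)[OF A F(3) F(4) p x]
      dir_deriv_two_form(1)[OF A F(1) F(3) p x] dir_deriv_two_form(1)[OF A F(4) F(2) p x]
      dir_deriv_two_form(1)[OF A F(1) F(4) p x] dir_deriv_two_form(1)[OF A F(2) F(3) p x]
    by (simp add: algebra_simps)
  show "diff_at p (\<lambda>q. \<Psi> q (Y q) (Z q) (W q) (X q))"
    unfolding \<Psi>_def wedge_square_def two_form_def by (rule diff_at_wedge[OF d pT])
qed

lemma cov_deriv_fundamental_form: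
  assumes IJK: "skew_field U I" "skew_field U J" "skew_field U K"
    and B: "\<And>q. q \<in> U \<Longrightarrow> pq_basis_at M g V q (I q) (J q) (K q)"
    and p: "p \<in> U" and x: "x \<in> tangent p"
    and args: "y \<in> tangent p" "z \<in> tangent p" "w \<in> tangent p" "u \<in> tangent p"
  shows "cov_deriv_form4 M D (fundamental_form M g V) p x y z w u =
    2 * para_quaternionic_hermitian.dform (g p) (I p) (J p) (K p)
      (nabla_endo I p x) (nabla_endo J p x) (nabla_endo K p x) y z w u"
proof -
  note U = skew_fieldD(1)[OF IJK(1)]
  note pT = openin_topspace[OF U p]
  interpret para_quaternionic_hermitian "tangent p" "g p" "I p" "J p" "K p"
    by (rule pq_basis_hermitian[OF B[OF p] pT])
  define Y Z W X where fields: "Y = extend_tvec M p y" "Z = extend_tvec M p z"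
    "W = extend_tvec M p w" "X = extend_tvec M p u"
  obtain U1 where 1: "openin (mtop M) U1" "p \<in> U1" "vector_field M U1 Y" "Y p = y"
    using extend_tvec[OF pT args(1)] fields by metis
  obtain U2 where 2: "openin (mtop M) U2" "p \<in> U2" "vector_field M U2 Z" "Z p = z"
    using extend_tvec[OF pT args(2)] fields by metis
  obtain U3 where 3: "openin (mtop M) U3" "p \<in> U3" "vector_field M U3 W" "W p = w"
    using extend_tvec[OF pT args(3)] fields by metis
  obtain U4 where 4: "openin (mtop M) U4" "p \<in> U4" "vector_field M U4 X" "X p = u"
    using extend_tvec[OF pT args(4)] fields by metis
  let ?N = "U \<inter> (U1 \<inter> U2 \<inter> (U3 \<inter> U4))"
  have N: "openin (mtop M) ?N" "p \<in> ?N" using U 1 2 3 4 p by auto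
  have F: "vector_field M ?N Y" "vector_field M ?N Z" "vector_field M ?N W" "vector_field M ?N X"
    using 1(3) 2(3) 3(3) 4(3) by (auto elim!: vector_field_subset)
  have S: "skew_field ?N I" "skew_field ?N J" "skew_field ?N K"
    using IJK N(1) by (auto elim!: skew_field_subset)
  let ?w = "\<lambda>A q. wedge_square (two_form g q (A q)) (Y q) (Z q) (W q) (X q)"
  note DD = D_in[OF N(1) F(1) N(2) x] D_in[OF N(1) F(2) N(2) x] D_in[OF N(1) F(3) N(2) x]
    D_in[OF N(1) F(4) N(2) x]
  note diff = dir_deriv_wedge_square(2)[OF S(1) F N(2) x] dir_deriv_wedge_square(2)[OF S(2) F N(2) x]
    dir_deriv_wedge_square(2)[OF S(3) F N(2) x]
  \<comment> \<open>Near \<open>p\<close> the form is rewritten in the smooth local basis; a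
    directional derivative sees only this neighbourhood.\<close>
  have "dir_deriv M p x (\<lambda>q. fundamental_form M g V q (Y q) (Z q) (W q) (X q)) =
      dir_deriv M p x (\<lambda>q. ?w I q - ?w J q - ?w K q)"
    using vector_fieldD[OF F(1)] vector_fieldD[OF F(2)] vector_fieldD[OF F(3)] vector_fieldD[OF F(4)]
      openin_topspace[OF N(1)] B
    by (intro dir_deriv_cong[OF N] fundamental_form_eq) auto
  also have "\<dots> = dir_deriv M p x (?w I) - dir_deriv M p x (?w J) - dir_deriv M p x (?w K)"
    using dir_deriv_diff[OF diff_at_diff[OF diff(1,2) pT] diff(3) pT] dir_deriv_diff[OF diff(1,2) pT]
    by simp
  finally show ?thesis
    unfolding cov_deriv_form4_def Let_def fields[symmetric] dform_def
      fundamental_form_eq[OF B[OF p] pT DD(1) args(2,3,4)] fundamental_form_eq[OF B[OF p] pT args(1) DD(2) args(3,4)]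
      fundamental_form_eq[OF B[OF p] pT args(1,2) DD(3) args(4)] fundamental_form_eq[OF B[OF p] pT args(1,2,3) DD(4)]
      dir_deriv_wedge_square(1)[OF S(1) F N(2) x] dir_deriv_wedge_square(1)[OF S(2) F N(2) x]
      dir_deriv_wedge_square(1)[OF S(3) F N(2) x] 1(4) 2(4) 3(4) 4(4)
    by simp
qed

lemma nearly_nabla_basis:
  assumes near: "nearly_para_quaternion_kaehler M g V D"
    and IJK: "skew_field U I" "skew_field U J" "skew_field U K"
    and B: "\<And>q. q \<in> U \<Longrightarrow> pq_basis_at M g V q (I q) (J q) (K q)"
    and p: "p \<in> U" and x: "x \<in> tangent p"
    and A: "A \<in> {I, J, K}"
  obtains a b c where
    "\<And>z. z \<in> tangent p \<Longrightarrow> nabla_endo A p x z = a *\<^sub>R I p z + b *\<^sub>R J p z + c *\<^sub>R K p z"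
proof -
  note U = skew_fieldD(1)[OF IJK(1)]
  note pT = openin_topspace[OF U p]
  interpret para_quaternionic_hermitian "tangent p" "g p" "I p" "J p" "K p"
    by (rule pq_basis_hermitian[OF B[OF p] pT])
  have rels: "I q (I q y) = - 1 *\<^sub>R y" "J q (J q y) = 1 *\<^sub>R y" "K q (K q y) = 1 *\<^sub>R y"
    "K q y = 1 *\<^sub>R I q (J q y)" "K q y = - 1 *\<^sub>R J q (I q y)" if "q \<in> U" "y \<in> tangent q" for q y
    using B[OF that(1)] that(2) by (simp_all add: pq_basis_at_def para_quaternion_relations_def)
  \<comment> \<open>Established for every tangent direction and not just the given one, since a null
    direction is treated by means of two others.\<close>
  have var: "infinitesimal_variation (nabla_endo I p x) (nabla_endo J p x) (nabla_endo K p x)"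
    if x: "x \<in> tangent p" for x
  proof -
    have square: "nabla_endo I p x (I p y) + I p (nabla_endo I p x y) = 0"
      "nabla_endo J p x (J p y) + J p (nabla_endo J p x y) = 0"
      "nabla_endo K p x (K p y) + K p (nabla_endo K p x y) = 0" if "y \<in> tangent p" for y
      using nabla_endo_square[OF IJK(1) _ p x that, of "- 1"] nabla_endo_square[OF IJK(2) _ p x that, of 1]
        nabla_endo_square[OF IJK(3) _ p x that, of 1] rels
      by blast+
    have 1: "nabla_endo K p x y = 1 *\<^sub>R (nabla_endo I p x (J p y) + I p (nabla_endo J p x y))"
      if "y \<in> tangent p" for y
      by (rule nabla_endo_mult[OF IJK(1,2,3) _ p x that]) (rule rels(4))
    have 2: "nabla_endo K p x y = - 1 *\<^sub>R (nabla_endo J p x (I p y) + J p (nabla_endo I p x y))"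
      if "y \<in> tangent p" for y
      by (rule nabla_endo_mult[OF IJK(2,1,3) _ p x that]) (rule rels(5))
    show ?thesis
    proof (rule infinitesimal_variationI)
      show "A y \<in> tangent p" if "A \<in> {nabla_endo I p x, nabla_endo J p x, nabla_endo K p x}" "y \<in> tangent p" for A y
        using that(1) IJK[THEN nabla_endo_in, OF p x that(2)] by auto
      show "g p (A y) z = - g p y (A z)"
        if "A \<in> {nabla_endo I p x, nabla_endo J p x, nabla_endo K p x}" "y \<in> tangent p" "z \<in> tangent p" for A y z
        using that(1) IJK[THEN nabla_endo_skew, OF p x that(2,3)] by auto
      fix y assume y: "y \<in> tangent p"
      show "nabla_endo I p x (I p y) = - I p (nabla_endo I p x y)"
        "nabla_endo J p x (J p y) = - J p (nabla_endo J p x y)"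
        "nabla_endo K p x (K p y) = - K p (nabla_endo K p x y)"
        using square[OF y] by (simp_all only: eq_neg_iff_add_eq_0)
      show "nabla_endo K p x y = nabla_endo I p x (J p y) + I p (nabla_endo J p x y)"
        using 1[OF y] by simp
      show "nabla_endo K p x y = - nabla_endo J p x (I p y) - J p (nabla_endo I p x y)"
        using 2[OF y] by simp
    qed
  qed
  have zero: "dform (nabla_endo I p x) (nabla_endo J p x) (nabla_endo K p x) x y z w = 0"
    if args: "x \<in> tangent p" "y \<in> tangent p" "z \<in> tangent p" "w \<in> tangent p" for x y z w
  proof -
    have "cov_deriv_form4 M D (fundamental_form M g V) p x x y z w = 0"
      using near pT args by (simp add: nearly_para_quaternion_kaehler_def)
    then show ?thesis using cov_deriv_fundamental_form[OF IJK B p args(1,1-4)] by simp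
  qed
  have add: "nabla_endo I p (x + y) z = nabla_endo I p x z + nabla_endo I p y z \<and>
      nabla_endo J p (x + y) z = nabla_endo J p x z + nabla_endo J p y z \<and>
      nabla_endo K p (x + y) z = nabla_endo K p x z + nabla_endo K p y z"
    if "x \<in> tangent p" "y \<in> tangent p" "z \<in> tangent p" for x y z
    using IJK[THEN nabla_endo_add, OF p that] by blast
  have "in_span (nabla_endo I p x) \<and> in_span (nabla_endo J p x) \<and> in_span (nabla_endo K p x)"
    by (rule nearly_parallel[OF var add zero x])
  then have "in_span (nabla_endo A p x)" using A by auto
  then show thesis unfolding in_span_def using that by blast
qed

section \<open>Derivatives of arbitrary sections\<close>

lemma section_skew_field:
  assumes "openin (mtop M) U" "section_on M V U A"
  shows "skew_field U A"
proof -
  have "skew_at M g q (A q)" if q: "q \<in> U" for q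
  proof -
    note qT = openin_topspace[OF assms(1) q]
    obtain N I J K where N: "q \<in> N" "\<And>q. q \<in> N \<Longrightarrow> pq_basis_at M g V q (I q) (J q) (K q)"
      using local_basis[OF qT] by metis
    interpret para_quaternionic_hermitian "tangent q" "g q" "I q" "J q" "K q"
      by (rule pq_basis_hermitian[OF N(2)[OF N(1)] qT])
    have "A q \<in> V q" using assms(2) q by (simp add: section_on_def)
    then obtain a b c where "\<And>z. A q z = a *\<^sub>R I q z + b *\<^sub>R J q z + c *\<^sub>R K q z"
      using pq_basis_span[OF N(2)[OF N(1)]] by metis
    then show ?thesis by (simp add: skew_at_def)
  qed
  then show ?thesis using assms by (simp add: skew_field_def section_on_def)
qed

text \<open>The product rule reduces a section to the local basis, but requires smooth coefficients.
  Multiplying \<open>A\<close> by the square \<open>f\<close> of a field that is non-null at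
  \<open>p\<close> makes all coefficients values of \<open>g\<close> on smooth fields; division by
  \<open>f\<close> then takes place at \<open>p\<close> alone.\<close>

lemma nearly_nabla_section:
  assumes near: "nearly_para_quaternion_kaehler M g V D"
    and U: "openin (mtop M) U" and A: "section_on M V U A" and p: "p \<in> U" and x: "x \<in> tangent p"
  shows "nabla_endo A p x \<in> V p"
proof -
  note pT = openin_topspace[OF U p]
  note skA = section_skew_field[OF U A]
  obtain N I J K where N: "p \<in> N" and IJK: "skew_field N I" "skew_field N J" "skew_field N K"
    and B: "\<And>q. q \<in> N \<Longrightarrow> pq_basis_at M g V q (I q) (J q) (K q)"
    using local_basis[OF pT] by metis
  interpret para_quaternionic_hermitian "tangent p" "g p" "I p" "J p" "K p"
    by (rule pq_basis_hermitian[OF B[OF N] pT])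
  obtain v where "v \<in> tangent p" "v \<noteq> 0" using pq_basis_nontrivial[OF B[OF N] pT] .
  then obtain y where y: "y \<in> tangent p" "g p y y \<noteq> 0" using nonnull_exists by blast
  define N0 where "N0 = U \<inter> N"
  have N0: "openin (mtop M) N0" "p \<in> N0" "N0 \<subseteq> U" "N0 \<subseteq> N"
    using U p N skew_fieldD(1)[OF IJK(1)] by (auto simp: N0_def)
  obtain a b c where I': "\<And>z. z \<in> tangent p \<Longrightarrow> nabla_endo I p x z = a *\<^sub>R I p z + b *\<^sub>R J p z + c *\<^sub>R K p z"
    using nearly_nabla_basis[OF near IJK B N x, of I] by auto
  obtain a' b' c' where J': "\<And>z. z \<in> tangent p \<Longrightarrow> nabla_endo J p x z = a' *\<^sub>R I p z + b' *\<^sub>R J p z + c' *\<^sub>R K p z"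
    using nearly_nabla_basis[OF near IJK B N x, of J] by auto
  obtain a'' b'' c'' where K': "\<And>z. z \<in> tangent p \<Longrightarrow> nabla_endo K p x z = a'' *\<^sub>R I p z + b'' *\<^sub>R J p z + c'' *\<^sub>R K p z"
    using nearly_nabla_basis[OF near IJK B N x, of K] by auto
  have "A p \<in> V p" using A p by (simp add: section_on_def)
  then obtain \<alpha> \<beta> \<gamma> where Ap: "\<And>z. A p z = \<alpha> *\<^sub>R I p z + \<beta> *\<^sub>R J p z + \<gamma> *\<^sub>R K p z"
    using pq_basis_span[OF B[OF N]] by metis
  obtain W0 Y where W0: "openin (mtop M) W0" "p \<in> W0" "W0 \<subseteq> N0" "vector_field M W0 Y" "Y p = y"
    using common_extension[OF N0(1,2) y(1) y(1)] by metis
  define f hI hJ hK where h: "f = (\<lambda>q. g q (Y q) (Y q))" "hI = (\<lambda>q. g q (A q (Y q)) (I q (Y q)))"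
    "hJ = (\<lambda>q. g q (Y q) (A q (J q (Y q))))" "hK = (\<lambda>q. g q (Y q) (A q (K q (Y q))))"
  note skA0 = skew_field_subset[OF skA W0(1) order_trans[OF W0(3) N0(3)]]
  note IJK0 = IJK[THEN skew_field_subset, OF W0(1) order_trans[OF W0(3) N0(4)]]
  note fieldA = skew_fieldD(5)[OF skA0] and fieldI = skew_fieldD(5)[OF IJK0(1)]
    and fieldJ = skew_fieldD(5)[OF IJK0(2)] and fieldK = skew_fieldD(5)[OF IJK0(3)]
  have smooth: "smooth_function M W0 f" "smooth_function M W0 hI" "smooth_function M W0 hJ" "smooth_function M W0 hK"
    unfolding h by (intro metric_smooth fieldA fieldI fieldJ fieldK W0 order_refl)+
  have expand: "f q *\<^sub>R A q z = hI q *\<^sub>R I q z + hJ q *\<^sub>R J q z + hK q *\<^sub>R K q z"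
    if q: "q \<in> W0" and z: "z \<in> tangent q" for q z
  proof -
    have qN: "q \<in> U" "q \<in> N" using q W0(3) N0 by auto
    note qT = openin_topspace[OF U qN(1)]
    interpret Q: para_quaternionic_hermitian "tangent q" "g q" "I q" "J q" "K q"
      by (rule pq_basis_hermitian[OF B[OF qN(2)] qT])
    have "A q \<in> V q" using A qN by (simp add: section_on_def)
    then obtain a b c where Aq: "\<And>z. A q z = a *\<^sub>R I q z + b *\<^sub>R J q z + c *\<^sub>R K q z"
      using pq_basis_span[OF B[OF qN(2)]] by metis
    have "hI q = a * f q" "hJ q = b * f q" "hK q = c * f q"
      unfolding h using Q.span_coefficients[OF Aq vector_fieldD[OF W0(4) q]] by simp_all
    then show ?thesis by (simp add: Aq scaleR_add_right mult.commute)
  qed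
  define d where "d = dir_deriv M p x"
  have main: "f p *\<^sub>R nabla_endo A p x z = d hI *\<^sub>R I p z + d hJ *\<^sub>R J p z + d hK *\<^sub>R K p z +
      hI p *\<^sub>R nabla_endo I p x z + hJ p *\<^sub>R nabla_endo J p x z + hK p *\<^sub>R nabla_endo K p x z - d f *\<^sub>R A p z"
    if z: "z \<in> tangent p" for z
  proof -
    obtain W Z where W: "openin (mtop M) W" "p \<in> W" "W \<subseteq> W0" "vector_field M W Z" "Z p = z"
      using common_extension[OF W0(1,2) z z] by metis
    note sm = smooth[THEN smooth_function_subset, OF W(3)]
    note F = fieldA[OF W(1,3,4)] fieldI[OF W(1,3,4)] fieldJ[OF W(1,3,4)] fieldK[OF W(1,3,4)]
    note SF = vector_field_scaleR[OF W(1) sm(1) F(1)] vector_field_scaleR[OF W(1) sm(2) F(2)]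
      vector_field_scaleR[OF W(1) sm(3) F(3)] vector_field_scaleR[OF W(1) sm(4) F(4)]
    note IJ = vector_field_add[OF W(1) SF(2,3)]
    have "D p x (\<lambda>q. f q *\<^sub>R A q (Z q)) =
        D p x (\<lambda>q. hI q *\<^sub>R I q (Z q) + hJ q *\<^sub>R J q (Z q) + hK q *\<^sub>R K q (Z q))"
      using expand vector_fieldD[OF W(4)] W(3)
      by (intro D_cong[OF W(1) SF(1) W(2) vector_field_add[OF W(1) IJ SF(4)] x]) auto
    also have "\<dots> = D p x (\<lambda>q. hI q *\<^sub>R I q (Z q)) + D p x (\<lambda>q. hJ q *\<^sub>R J q (Z q)) +
        D p x (\<lambda>q. hK q *\<^sub>R K q (Z q))"
      using D_add[OF W(1) IJ W(2) SF(4) x] D_add[OF W(1) SF(2) W(2) SF(3) x] by simp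
    finally have eq: "d f *\<^sub>R A p z + f p *\<^sub>R D p x (\<lambda>q. A q (Z q)) =
        d hI *\<^sub>R I p z + hI p *\<^sub>R D p x (\<lambda>q. I q (Z q)) +
        (d hJ *\<^sub>R J p z + hJ p *\<^sub>R D p x (\<lambda>q. J q (Z q))) +
        (d hK *\<^sub>R K p z + hK p *\<^sub>R D p x (\<lambda>q. K q (Z q)))"
      using D_scaleR[OF W(1) F(1) W(2) sm(1) x] D_scaleR[OF W(1) F(2) W(2) sm(2) x]
        D_scaleR[OF W(1) F(3) W(2) sm(3) x] D_scaleR[OF W(1) F(4) W(2) sm(4) x] W(5)
      by (simp add: d_def)
    note p0 = W0(2)
    have N': "D p x (\<lambda>q. A q (Z q)) = nabla_endo A p x z + A p (D p x Z)"
      "D p x (\<lambda>q. I q (Z q)) = nabla_endo I p x z + I p (D p x Z)"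
      "D p x (\<lambda>q. J q (Z q)) = nabla_endo J p x z + J p (D p x Z)"
      "D p x (\<lambda>q. K q (Z q)) = nabla_endo K p x z + K p (D p x Z)"
      using nabla_endo_eq[OF skA0 p0 x W(1,4,2)] IJK0[THEN nabla_endo_eq, OF p0 x W(1,4,2)] W(5)
      by (simp_all add: nabla_def)
    \<comment> \<open>The terms containing \<open>D p x Z\<close> cancel: they are the expansion of
      \<open>f A\<close> applied to that vector.\<close>
    show ?thesis
      using eq expand[OF p0 D_in[OF W(1,4,2) x]] unfolding N'
      by (simp add: scaleR_add_right algebra_simps)
  qed
  have fp: "f p \<noteq> 0" using y W0(5) by (simp add: h)
  define r where "r = inverse (f p)"
  define A1 B1 C1 where "A1 = r * (d hI + hI p * a + hJ p * a' + hK p * a'' - d f * \<alpha>)"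
    "B1 = r * (d hJ + hI p * b + hJ p * b' + hK p * b'' - d f * \<beta>)"
    "C1 = r * (d hK + hI p * c + hJ p * c' + hK p * c'' - d f * \<gamma>)"
  note ABC = this
  have apply_sum: "(A1 *\<^sub>R I p + B1 *\<^sub>R J p + C1 *\<^sub>R K p) z =
      A1 *\<^sub>R I p z + B1 *\<^sub>R J p z + C1 *\<^sub>R K p z" for z
    by (simp add: scaleR_fun_def)
  have "nabla_endo A p x z = (A1 *\<^sub>R I p + B1 *\<^sub>R J p + C1 *\<^sub>R K p) z" for z
  proof (cases "z \<in> tangent p")
    case True
    have "nabla_endo A p x z = r *\<^sub>R (f p *\<^sub>R nabla_endo A p x z)" using fp by (simp add: r_def)
    also have "\<dots> = A1 *\<^sub>R I p z + B1 *\<^sub>R J p z + C1 *\<^sub>R K p z"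
      unfolding main[OF True] I'[OF True] J'[OF True] K'[OF True] Ap ABC
      by (simp add: algebra_simps)
    finally show ?thesis unfolding apply_sum .
  next
    \<comment> \<open>Membership in \<open>V p\<close> is an equation between total functions, so
      the default value 0 outside the tangent space has to agree as well.\<close>
    case False
    then have "I p z = 0" "J p z = 0" "K p z = 0"
      using B[OF N] by (auto simp: pq_basis_at_def endo_space_def)
    with False show ?thesis unfolding apply_sum by (simp add: cov_deriv_endo_def)
  qed
  then have "nabla_endo A p x = A1 *\<^sub>R I p + B1 *\<^sub>R J p + C1 *\<^sub>R K p" ..
  moreover have "V p = span {I p, J p, K p}" using B[OF N] by (simp add: pq_basis_at_def)
  ultimately show ?thesis using in_span3 by blast
qed

lemma nabla_endo_field:
  assumes A: "skew_field U A" and X: "vector_field M U X"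
  shows "endo_field M U (\<lambda>p. nabla_endo A p (X p))"
  unfolding endo_field_def
proof (intro conjI ballI allI impI)
  note U = skew_fieldD(1)[OF A]
  fix p assume p: "p \<in> U"
  note Xp = vector_fieldD[OF X p]
  interpret pseudo_euclidean "tangent p" "g p" by (rule pseudo_euclidean_tangent[OF openin_topspace[OF U p]])
  \<comment> \<open>Skewness alone yields linearity in the vector argument.\<close>
  have "linear_on_subspace (tangent p) (nabla_endo A p (X p))"
    by (rule skew_imp_linear) (use nabla_endo_in[OF A p Xp] nabla_endo_skew[OF A p Xp] in auto)
  then show "nabla_endo A p (X p) \<in> endo_space M p"
    using nabla_endo_in[OF A p Xp] by (simp add: endo_space_def cov_deriv_endo_def)
next
  note U = skew_fieldD(1)[OF A]
  fix W Y assume "openin (mtop M) W \<and> W \<subseteq> U \<and> vector_field M W Y"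
  then have W: "openin (mtop M) W" "W \<subseteq> U" "vector_field M W Y" by auto
  have XW: "vector_field M W X" using vector_field_subset[OF X W(2)] .
  have "vector_field M W (\<lambda>p. D p (X p) (\<lambda>q. A q (Y q)) - A p (D p (X p) Y))"
    by (intro vector_field_diff D_field skew_fieldD(5)[OF A] W XW)
  then show "vector_field M W (\<lambda>p. nabla_endo A p (X p) (Y p))"
  proof (rule vector_field_cong[OF W(1), rotated])
    fix p assume p: "p \<in> W"
    then have pU: "p \<in> U" using W(2) by auto
    show "D p (X p) (\<lambda>q. A q (Y q)) - A p (D p (X p) Y) = nabla_endo A p (X p) (Y p)"
      using nabla_endo_eq[OF A pU vector_fieldD[OF X pU] W(1,3) p] by (simp add: nabla_def)
  qed
qed

end

theorem theorem1:
  fixes M :: "('m, 'e::euclidean_space) manifold"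
    and g :: "('m, 'e) tensor2"
    and V :: "'m \<Rightarrow> ('m, 'e) tend set"
    and D :: "('m, 'e) connection"
  assumes "almost_para_quaternion_hermitian M g V"
    and "levi_civita_connection M g D"
    and "nearly_para_quaternion_kaehler M g V D"
  shows "para_quaternion_kaehler M V D"
proof -
  interpret almost_pq_connection M g D V
    using assms
    by unfold_locales (simp_all add: almost_para_quaternion_hermitian_def levi_civita_connection_def)
  show ?thesis
    unfolding para_quaternion_kaehler_def
  proof (intro allI impI)
    fix U A X assume "openin (mtop M) U \<and> section_on M V U A \<and> vector_field M U X"
    then have *: "openin (mtop M) U" "section_on M V U A" "vector_field M U X" by auto
    show "section_on M V U (\<lambda>p. cov_deriv_endo M D A p (X p))"
      unfolding section_on_def
      using nabla_endo_field[OF section_skew_field[OF *(1,2)] *(3)]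
        nearly_nabla_section[OF assms(3) *(1,2)] vector_fieldD[OF *(3)] by blast
  qed
qed

end
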